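(* Assume that the numerical solutions $\mathbf U_h^C,\mathbf U_h^D$ (at a given time) and the projected stationary hydrostatic solutions $\mathbf U_h^{s,C},\mathbf U_h^{s,D}$ satisfy $$\mathbf U_h^C(x)\in G,\ \ \mathbf U_h^{s,C}(x)\in G\quad\forall x\in\mathbb S_j,\ \forall j,\qquad \mathbf U_h^D(x)\in G,\ \ \mathbf U_h^{s,D}(x)\in G\quad\forall x\in\mathbb S_{j+\frac12},\ \forall j .$$ If $\overline{\mathbf U}_j^C,\overline{\mathbf U}_{j+\frac12}^D\in G$ for all $j$, then $$\overline{\mathbf U}_j^C+\Delta t\,\mathbf L_j^C(\mathbf U_h^C,\mathbf U_h^D)\in G,\qquad \overline{\mathbf U}_{j+\frac12}^D+\Delta t\,\mathbf L_{j+\frac12}^D(\mathbf U_h^D,\mathbf U_h^C)\in G,\qquad\forall j,$$ under the CFL-type condition $$\frac{\Delta t}{\Delta x}\tilde\alpha_x<\frac{\theta\hat\omega_1}2,\qquad \tilde\alpha_x=\max_j\max\{\tilde\alpha_j^D,\tilde\alpha_{j+\frac12}^C\},\qquad \theta=\frac{\Delta t}{\tau_{max}}\in(0,1].$$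
   Context: **Equations.** One-dimensional Euler equations with gravitational potential $\phi(x)$: $\mathbf U_t+\mathbf F(\mathbf U)_x=\mathbf S(\mathbf U,\phi_x)$, $\mathbf U=(\rho,m,E)^\top$, $m=\rho u$, $\mathbf F(\mathbf U)=(\rho u,\rho u^2+p,(E+p)u)^\top$, $\mathbf S=(0,-\rho\phi_x,-m\phi_x)^\top$, $p(\mathbf U)=(\gamma-1)(E-\frac{m^2}{2\rho})$, $\gamma>1$. Admissible set: $G=\{(\rho,m,E)^\top:\rho>0,\ p(\mathbf U)>0\}$. Also $a_x(\mathbf U)=|u|+\sqrt{\gamma p/\rho}$. A known stationary hydrostatic solution $\rho^s(x)$, $u^s=0$, $p^s(x)$ with $(p^s)_x=-\rho^s\phi_x$ is given, and $\mathbf U^s=(\rho^s,0,p^s/(\gamma-1))^\top$. **Meshes and spaces.** Uniform grid with step $\Delta x$: points $x_r$, $r$ integer or half-integer, $x_{r+\frac12}-x_r=\Delta x/2$. For such $r$ put $I_r=(x_{r-\frac12},x_{r+\frac12})$, $I_r^-=(x_{r-\frac12},x_r)$, $I_r^+=(x_r,x_{r+\frac12})$. The cells $I_j$ ($j$ integer) form the primal mesh (label $C$), the cells $I_{j+\frac12}$ the dual mesh (label $D$). $\mathbb V_h^{C,k}$, $\mathbb V_h^{D,k}$ are the spaces of functions that are polynomials of degree at most $k$ on each primal, respectively dual, cell; $k\ge1$; $\mathbf U_h^C\in[\mathbb V_h^{C,k}]^3$, $\mathbf U_h^D\in[\mathbb V_h^{D,k}]^3$. There are finitely many cells; conclusions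 "for all $j$" range over those cells $I_r$ for which both overlapping cells $I_{r\pm\frac12}$ of the other mesh are present (boundary treatment is not part of the statement). For a cell $I_r$ write $(A,B)=(C,D)$ if $r$ is an integer and $(A,B)=(D,C)$ if $r$ is a half-integer. Cell averages: $\overline{(g)}_r=\frac1{\Delta x}\int_{I_r}g\,dx$; $\overline{\mathbf U}_r^C,\overline{\mathbf U}_r^D$ are the averages over $I_r$ of $\mathbf U_h^C,\mathbf U_h^D$. The values of a piecewise polynomial at endpoints of one of its own cells, when that cell is under consideration, are one-sided limits from inside the cell; $f(x^\pm)$ denotes one-sided limits. **Projection.** $\mathcal P_h^A(f)\in\mathbb V_h^{A,k}$ is determined on each cell $I_r$ of mesh $A$ by $\int_{I_r^-}\mathcal P_h^A(f)dx=\int_{I_r^-}f\,dx$ and $\int_{I_r}\mathcal P_h^A(f)v\,dx=\int_{I_r}fv\,dx$ for all $v\in\mathrm{span}\{\Phi_0,\Phi_2,\dots,\Phi_k\}$, where $\Phi_0=1,\Phi_1=\xi,\Phi_2=\xi^2-\frac13,\dots$ are the monic Legendre polynomials in $\xi=2(x-x_r)/\Delta x$. $\mathbf U_h^{s,A}$ is the componentwise projection of $\mathbf U^s$; $\rho_h^{s,A}=\mathcal P_h^A(\rho^s)$, $p_h^{s,A}=\mathcal P_h^A(p^s)$. **Quadrature.** $\{x_r^{1,\alpha}\}_{\alpha=1}^N$, $\{x_r^{2,\alpha}\}_{\alpha=1}^N$: $N$-point Gauss nodes in $[x_{r-\frac12},x_r]$ and $[x_r,x_{r+\frac12}]$, weights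 $\omega_\alpha$ with $\sum_\alpha\omega_\alpha=1$, $N\ge k+1$; $\mathbb Q_r$ is the set of all these $2N$ nodes. $\{\hat x_r^{1,\beta}\}_{\beta=1}^L$, $\{\hat x_r^{2,\beta}\}_{\beta=1}^L$: $L$-point Gauss–Lobatto nodes in the same two intervals, weights $\hat\omega_\beta$ with $\sum_\beta\hat\omega_\beta=1$, $L=\lceil\frac{k+3}2\rceil$; $\hat\omega_1$ is the first (endpoint) weight. $\mathbb S_r$ is the union of all these Gauss and Gauss–Lobatto nodes. **Cell-average operators** (obtained by taking test function $1$ in the modified CDG scheme). With $\mathbf Q=(0,\rho,m)^\top$, $$\mathbf L_r^A(\mathbf U_h^A,\mathbf U_h^B)=\frac{\overline{\mathbf U}_r^B-\overline{\mathbf U}_r^A}{\tau_{max}}-\frac{\mathbf F(\mathbf U_h^B(x_{r+\frac12}))-\mathbf F(\mathbf U_h^B(x_{r-\frac12}))}{\Delta x}+\frac{\langle\mathbf S_h^B,1\rangle_r}{\Delta x},$$ $$\langle\mathbf S_h^B,1\rangle_r=\frac{\overline{(\mathbf Q_h^B)}_r}{\overline{(\rho_h^{s,B})}_r}\big(p_h^{s,B}(x_{r+\frac12})-p_h^{s,B}(x_{r-\frac12})\big)+\frac{\Delta x}2\sum_{\kappa=1}^2\sum_{\alpha=1}^N\omega_\alpha\Big(\frac{\mathbf Q_h^B}{\rho_h^{s,B}}(x_r^{\kappa,\alpha})-\frac{\overline{(\mathbf Q_h^B)}_r}{\overline{(\rho_h^{s,B})}_r}\Big)(p_h^{s,B})_x(x_r^{\kappa,\alpha}).$$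 Here $\tau_{max}>0$ is a given time scale and $\Delta t>0$ the time step. **Wave-speed parameters.** For each cell $I_r$ (so $\tilde\alpha_j^D$ for $r=j$, $\tilde\alpha_{j+\frac12}^C$ for $r=j+\frac12$): $\tilde\alpha_r^B=\tilde\alpha_{1,r}^B+\tilde\alpha_{2,r}^B$, $$\tilde\alpha_{1,r}^B=\max_{x\in\{x_{r-\frac12},x_{r+\frac12}\}}a_x(\mathbf U_h^B(x)),\qquad \tilde\alpha_{2,r}^B=\frac{\hat\omega_1\Delta x}2\max_{x\in\mathbb Q_r}\Big\{|(\hat\phi_h^B)_x|\sqrt{\frac{(\gamma-1)\rho_h^B}{2p_h^B}}\Big\},$$ $$(\hat\phi_h^B)_x=\frac{p_h^{s,B}(x_r^-)-p_h^{s,B}(x_r^+)}{\overline{(\rho_h^{s,B})}_r\,\Delta x}-\frac{(p_h^{s,B})_x}{\rho_h^{s,B}},$$ where $p_h^B=p(\mathbf U_h^B)$. *)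

theory Defs
  imports "HOL-Analysis.Analysis" "HOL-Computational_Algebra.Polynomial"
begin

section \<open>Euler equations with gravity\<close>

text \<open>A state is \<open>U = (\<rho>, m, E)\<close>, stored as \<open>U $ 1, U $ 2, U $ 3\<close>.\<close>

definition velocity :: "real^3 \<Rightarrow> real" where
  "velocity U = U $ 2 / U $ 1"

definition pressure :: "real \<Rightarrow> real^3 \<Rightarrow> real" where
  "pressure \<gamma> U = (\<gamma> - 1) * (U $ 3 - (U $ 2)\<^sup>2 / (2 * U $ 1))"

definition flux :: "real \<Rightarrow> real^3 \<Rightarrow> real^3" where
  "flux \<gamma> U = vector
     [U $ 1 * velocity U,
      U $ 1 * (velocity U)\<^sup>2 + pressure \<gamma> U,
      (U $ 3 + pressure \<gamma> U) * velocity U]"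

definition admissible :: "real \<Rightarrow> (real^3) set" where
  "admissible \<gamma> = {U. U $ 1 > 0 \<and> pressure \<gamma> U > 0}"

definition wave_speed :: "real \<Rightarrow> real^3 \<Rightarrow> real" where
  "wave_speed \<gamma> U = \<bar>velocity U\<bar> + sqrt (\<gamma> * pressure \<gamma> U / U $ 1)"

text \<open>The source term is \<open>S(U, \<phi>\<^sub>x) = - \<phi>\<^sub>x Q(U)\<close> with the following \<open>Q\<close>.\<close>

definition source_vec :: "real^3 \<Rightarrow> real^3" where
  "source_vec U = vector [0, U $ 1, U $ 2]"

definition hydrostatic_state ::
    "real \<Rightarrow> (real \<Rightarrow> real) \<Rightarrow> (real \<Rightarrow> real) \<Rightarrow> real \<Rightarrow> real^3" where
  "hydrostatic_state \<gamma> \<rho>s ps y = vector [\<rho>s y, 0, ps y / (\<gamma> - 1)]"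


section \<open>Legendre polynomials and quadrature on the reference interval \<open>[-1, 1]\<close>\<close>

text \<open>Monic Legendre polynomials, by Rodrigues' formula.\<close>

definition legendre :: "nat \<Rightarrow> real poly" where
  "legendre n = smult (fact n / fact (2 * n)) ((pderiv ^^ n) ([:-1, 0, 1:] ^ n))"

lemma legendre_0: "legendre 0 = 1"
  and legendre_1: "legendre 1 = [:0, 1:]"
  and legendre_2: "legendre 2 = [:- 1 / 3, 0, 1:]"
  by (simp_all add: legendre_def numeral_2_eq_2 pderiv_pCons pderiv_mult fact_numeral)

text \<open>The weight of \<open>\<xi>\<close> in the interpolatory rule with node set \<open>X\<close>: the mean value over
  \<open>[-1, 1]\<close> of the Lagrange basis polynomial of \<open>\<xi>\<close>. With this normalization the weights
  sum up to 1. Rules are indexed by their nodes rather than by \<open>1, \<dots>, N\<close>.\<close>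

definition interp_weight :: "real set \<Rightarrow> real \<Rightarrow> real" where
  "interp_weight X \<xi> =
     integral {-1..1} (\<lambda>t. \<Prod>\<eta>\<in>X - {\<xi>}. (t - \<eta>) / (\<xi> - \<eta>)) / 2"

definition gauss_nodes :: "nat \<Rightarrow> real set" where
  "gauss_nodes N = {\<xi>. poly (legendre N) \<xi> = 0}"

definition gauss_weight :: "nat \<Rightarrow> real \<Rightarrow> real" where
  "gauss_weight N = interp_weight (gauss_nodes N)"

text \<open>The \<open>L\<close>-point rule, meant for \<open>L \<ge> 2\<close>.\<close>

definition lobatto_nodes :: "nat \<Rightarrow> real set" where
  "lobatto_nodes L = {-1, 1} \<union> {\<xi>. poly (pderiv (legendre (L - 1))) \<xi> = 0}"

definition lobatto_weight :: "nat \<Rightarrow> real \<Rightarrow> real" where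
  "lobatto_weight L = interp_weight (lobatto_nodes L)"

definition lobatto_size :: "nat \<Rightarrow> nat" where
  "lobatto_size k = nat \<lceil>(real k + 3) / 2\<rceil>"

definition lobatto_end_weight :: "nat \<Rightarrow> real" where
  "lobatto_end_weight k = lobatto_weight (lobatto_size k) (-1)"


section \<open>Overlapping meshes\<close>

text \<open>Integer and half-integer indices \<open>r\<close> are encoded by the integer \<open>i = 2 r\<close>. Thus
  \<open>x i\<close> is the point \<open>x\<^sub>r\<close>, \<open>x (i \<plusminus> 1)\<close> are the points \<open>x\<^sub>r\<^sub>\<plusminus>\<^sub>1\<^sub>/\<^sub>2\<close>, and the
  cell \<open>I\<^sub>r\<close> belongs to the primal mesh if \<open>i\<close> is even and to the dual mesh if \<open>i\<close> is odd.
  A finite set \<open>K\<close> of such integers lists the cells that are present.\<close>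

definition uniform_grid :: "(int \<Rightarrow> real) \<Rightarrow> real \<Rightarrow> bool" where
  "uniform_grid x dx \<longleftrightarrow> dx > 0 \<and> (\<forall>i. x (i + 1) - x i = dx / 2)"

definition primal_cells :: "int set \<Rightarrow> int set" where
  "primal_cells K = {i \<in> K. even i}"

definition dual_cells :: "int set \<Rightarrow> int set" where
  "dual_cells K = {i \<in> K. odd i}"

text \<open>The cells both of whose overlapping cells of the other mesh are present.\<close>

definition both_overlaps :: "int set \<Rightarrow> int set" where
  "both_overlaps K = {i \<in> K. i - 1 \<in> K \<and> i + 1 \<in> K}"

definition cell :: "(int \<Rightarrow> real) \<Rightarrow> int \<Rightarrow> real set" where
  "cell x i = {x (i - 1)<..<x (i + 1)}"

definition left_half :: "(int \<Rightarrow> real) \<Rightarrow> int \<Rightarrow> real set" where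
  "left_half x i = {x (i - 1)<..<x i}"

definition mesh_domain :: "(int \<Rightarrow> real) \<Rightarrow> int set \<Rightarrow> real set" where
  "mesh_domain x K = (\<Union>i\<in>K. {x (i - 1)..x (i + 1)})"

text \<open>\<open>J\<close> is the set of cells of one mesh, \<open>primal_cells K\<close> or \<open>dual_cells K\<close>. The values of a
  piecewise polynomial at the cell interfaces are left open.\<close>

definition pw_poly :: "(int \<Rightarrow> real) \<Rightarrow> int set \<Rightarrow> nat \<Rightarrow> (real \<Rightarrow> real) set" where
  "pw_poly x J k = {f. \<forall>i\<in>J. \<exists>q. degree q \<le> k \<and> (\<forall>y\<in>cell x i. f y = poly q y)}"

definition pw_poly3 :: "(int \<Rightarrow> real) \<Rightarrow> int set \<Rightarrow> nat \<Rightarrow> (real \<Rightarrow> real^3) set" where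
  "pw_poly3 x J k = {f. \<forall>c. (\<lambda>y. f y $ c) \<in> pw_poly x J k}"

text \<open>The value at a point \<open>y\<close> of the closed cell \<open>I\<^sub>r\<close>, taken from inside the cell.\<close>

definition cell_value ::
    "(int \<Rightarrow> real) \<Rightarrow> int \<Rightarrow> (real \<Rightarrow> 'a::t2_space) \<Rightarrow> real \<Rightarrow> 'a" where
  "cell_value x i f y = (if y \<in> cell x i then f y else Lim (at y within cell x i) f)"

definition cell_avg ::
    "(int \<Rightarrow> real) \<Rightarrow> real \<Rightarrow> int \<Rightarrow> (real \<Rightarrow> 'a::real_normed_vector) \<Rightarrow> 'a" where
  "cell_avg x dx i g = (1 / dx) *\<^sub>R integral (cell x i) g"

text \<open>\<open>g\<close> is the projection of \<open>f\<close>; the test function \<open>v\<close> runs through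
  the span of the Legendre polynomials of degree \<open>0, 2, \<dots>, k\<close>.\<close>

definition is_projection ::
    "(int \<Rightarrow> real) \<Rightarrow> real \<Rightarrow> int set \<Rightarrow> nat \<Rightarrow> (real \<Rightarrow> real) \<Rightarrow> (real \<Rightarrow> real) \<Rightarrow> bool" where
  "is_projection x dx J k f g \<longleftrightarrow>
     g \<in> pw_poly x J k \<and>
     (\<forall>i\<in>J.
        integral (left_half x i) g = integral (left_half x i) f \<and>
        (\<forall>c :: nat \<Rightarrow> real.
           let v = (\<lambda>y. \<Sum>n\<in>{0..k} - {1}. c n * poly (legendre n) (2 * (y - x i) / dx))
           in integral (cell x i) (\<lambda>y. g y * v y) = integral (cell x i) (\<lambda>y. f y * v y)))"

definition is_projection3 ::
    "(int \<Rightarrow> real) \<Rightarrow> real \<Rightarrow> int set \<Rightarrow> nat \<Rightarrow> (real \<Rightarrow> real^3) \<Rightarrow> (real \<Rightarrow> real^3) \<Rightarrow> bool" where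
  "is_projection3 x dx J k f g \<longleftrightarrow>
     (\<forall>c. is_projection x dx J k (\<lambda>y. f y $ c) (\<lambda>y. g y $ c))"

text \<open>The two halves of \<open>I\<^sub>r\<close> are \<open>[x \<kappa>, x (\<kappa> + 1)]\<close> with \<open>\<kappa> = i - 1\<close> and \<open>\<kappa> = i\<close>.\<close>

definition half_node :: "(int \<Rightarrow> real) \<Rightarrow> int \<Rightarrow> real \<Rightarrow> real" where
  "half_node x \<kappa> \<xi> = (x \<kappa> + x (\<kappa> + 1)) / 2 + (x (\<kappa> + 1) - x \<kappa>) / 2 * \<xi>"

definition gauss_points :: "(int \<Rightarrow> real) \<Rightarrow> nat \<Rightarrow> int \<Rightarrow> real set" where
  "gauss_points x N i = (\<Union>\<kappa>\<in>{i - 1, i}. half_node x \<kappa> ` gauss_nodes N)"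

definition all_points :: "(int \<Rightarrow> real) \<Rightarrow> nat \<Rightarrow> nat \<Rightarrow> int \<Rightarrow> real set" where
  "all_points x k N i =
     gauss_points x N i \<union> (\<Union>\<kappa>\<in>{i - 1, i}. half_node x \<kappa> ` lobatto_nodes (lobatto_size k))"


section \<open>Cell-average operators and wave-speed parameters\<close>

text \<open>Below, \<open>UA\<close> is the numerical solution on the mesh of the cell \<open>I\<^sub>r\<close>; \<open>UB\<close> and \<open>\<rho>sB\<close>, \<open>psB\<close>
  are the numerical solution and the projected hydrostatic density and pressure on the other mesh.
  The latter are smooth at \<open>x\<^sub>r\<^sub>\<plusminus>\<^sub>1\<^sub>/\<^sub>2\<close> and may jump at \<open>x\<^sub>r\<close>.\<close>

definition source_pairing ::
    "(int \<Rightarrow> real) \<Rightarrow> real \<Rightarrow> nat \<Rightarrow> int \<Rightarrow> (real \<Rightarrow> real^3) \<Rightarrow> (real \<Rightarrow> real) \<Rightarrow> (real \<Rightarrow> real) \<Rightarrow> real^3"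
  where
  "source_pairing x dx N i UB \<rho>sB psB =
     (let R = (1 / cell_avg x dx i \<rho>sB) *\<^sub>R cell_avg x dx i (\<lambda>y. source_vec (UB y))
      in (psB (x (i + 1)) - psB (x (i - 1))) *\<^sub>R R
         + (dx / 2) *\<^sub>R
           (\<Sum>\<kappa>\<in>{i - 1, i}. \<Sum>\<xi>\<in>gauss_nodes N.
              let y = half_node x \<kappa> \<xi>
              in (gauss_weight N \<xi> * deriv psB y) *\<^sub>R ((1 / \<rho>sB y) *\<^sub>R source_vec (UB y) - R)))"

definition cell_operator ::
    "real \<Rightarrow> (int \<Rightarrow> real) \<Rightarrow> real \<Rightarrow> real \<Rightarrow> nat \<Rightarrow> int \<Rightarrow>
     (real \<Rightarrow> real^3) \<Rightarrow> (real \<Rightarrow> real^3) \<Rightarrow> (real \<Rightarrow> real) \<Rightarrow> (real \<Rightarrow> real) \<Rightarrow> real^3" where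
  "cell_operator \<gamma> x dx \<tau>max N i UA UB \<rho>sB psB =
     (1 / \<tau>max) *\<^sub>R (cell_avg x dx i UB - cell_avg x dx i UA)
     - (1 / dx) *\<^sub>R (flux \<gamma> (UB (x (i + 1))) - flux \<gamma> (UB (x (i - 1))))
     + (1 / dx) *\<^sub>R source_pairing x dx N i UB \<rho>sB psB"

definition phi_hat_x ::
    "(int \<Rightarrow> real) \<Rightarrow> real \<Rightarrow> int \<Rightarrow> (real \<Rightarrow> real) \<Rightarrow> (real \<Rightarrow> real) \<Rightarrow> real \<Rightarrow> real" where
  "phi_hat_x x dx i \<rho>sB psB y =
     (Lim (at_left (x i)) psB - Lim (at_right (x i)) psB) / (cell_avg x dx i \<rho>sB * dx)
     - deriv psB y / \<rho>sB y"

definition alpha1 :: "real \<Rightarrow> (int \<Rightarrow> real) \<Rightarrow> int \<Rightarrow> (real \<Rightarrow> real^3) \<Rightarrow> real" where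
  "alpha1 \<gamma> x i UB = Max ((\<lambda>y. wave_speed \<gamma> (UB y)) ` {x (i - 1), x (i + 1)})"

definition alpha2 ::
    "real \<Rightarrow> (int \<Rightarrow> real) \<Rightarrow> real \<Rightarrow> nat \<Rightarrow> nat \<Rightarrow> int \<Rightarrow>
     (real \<Rightarrow> real^3) \<Rightarrow> (real \<Rightarrow> real) \<Rightarrow> (real \<Rightarrow> real) \<Rightarrow> real" where
  "alpha2 \<gamma> x dx k N i UB \<rho>sB psB =
     lobatto_end_weight k * dx / 2 *
     Max ((\<lambda>y. \<bar>phi_hat_x x dx i \<rho>sB psB y\<bar> *
                sqrt ((\<gamma> - 1) * UB y $ 1 / (2 * pressure \<gamma> (UB y)))) ` gauss_points x N i)"

definition alpha_cell ::
    "real \<Rightarrow> (int \<Rightarrow> real) \<Rightarrow> real \<Rightarrow> nat \<Rightarrow> nat \<Rightarrow> int \<Rightarrow>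
     (real \<Rightarrow> real^3) \<Rightarrow> (real \<Rightarrow> real) \<Rightarrow> (real \<Rightarrow> real) \<Rightarrow> real" where
  "alpha_cell \<gamma> x dx k N i UB \<rho>sB psB =
     alpha1 \<gamma> x i UB + alpha2 \<gamma> x dx k N i UB \<rho>sB psB"

definition alpha_max ::
    "real \<Rightarrow> (int \<Rightarrow> real) \<Rightarrow> real \<Rightarrow> nat \<Rightarrow> nat \<Rightarrow> int set \<Rightarrow>
     (real \<Rightarrow> real^3) \<Rightarrow> (real \<Rightarrow> real) \<Rightarrow> (real \<Rightarrow> real) \<Rightarrow>
     (real \<Rightarrow> real^3) \<Rightarrow> (real \<Rightarrow> real) \<Rightarrow> (real \<Rightarrow> real) \<Rightarrow> real" where
  "alpha_max \<gamma> x dx k N K UC \<rho>sC psC UD \<rho>sD psD =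
     Max ((\<lambda>i. alpha_cell \<gamma> x dx k N i UD \<rho>sD psD) ` primal_cells (both_overlaps K) \<union>
          (\<lambda>i. alpha_cell \<gamma> x dx k N i UC \<rho>sC psC) ` dual_cells (both_overlaps K))"

end

theory Submission
  imports Defs
begin

text \<open>Write \<open>\<eta>, \<beta> > 0\<close> for two shares with \<open>\<eta> + \<beta> = \<theta>\<close>, and \<open>\<nu> = \<Delta>t / \<Delta>x\<close>. With \<open>A\<close> and \<open>B\<close> the averages
  over one cell of the solution on its own mesh and on the other mesh, the updated average is

    \<open>(1 - \<theta>) A + (\<eta> B + \<nu> S) + (\<beta> B - \<nu> (F\<^sub>+ - F\<^sub>-))\<close>,

  where \<open>S\<close> is the discrete source and \<open>F\<^sub>\<plusminus>\<close> are the fluxes at the two ends of the cell. The admissible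
  states form a convex cone, because the pressure is homogeneous and superadditive; hence it
  suffices that the last two brackets are admissible. The same \<open>B\<close> is expanded by two different
  quadrature rules, each suited to its bracket.

  Gauss nodes, for the source: since \<open>p\<^sub>x\<close> is integrated exactly on each half cell, the
  hydrostatic terms of \<open>S\<close> telescope and leave only the jump of the pressure at the cell centre. So
  \<open>S / \<Delta>x\<close> is the weighted mean of \<open>- \<phi>\<^sub>x Q(U)\<close> over the nodes that represent \<open>B\<close>
  (\<open>source_pairing_quadrature\<close>), and the bracket is a positive combination of states
  \<open>U - (\<Delta>t / \<eta>) \<phi>\<^sub>x Q(U)\<close>. Such a state keeps a positive pressure if \<open>\<Delta>t\<close> times the maximum \<open>M\<close> defining
  the second wave speed parameter is below \<open>\<eta>\<close> (\<open>admissible_source\<close>).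

  Gauss--Lobatto nodes, for the flux: the ends of the cell are nodes of weight \<open>\<omega> / 2\<close>, and
  \<open>\<beta> (\<omega> / 2) U \<mp> \<nu> F(U)\<close> is admissible there if \<open>\<nu>\<close> times the wave speed is below \<open>\<beta> \<omega> / 2\<close>
  (\<open>admissible_flux\<close>).

  Shares \<open>\<eta>\<close> and \<open>\<beta>\<close> that meet both bounds exist if and only if \<open>\<Delta>t M + 2 \<nu> \<alpha>\<^sub>1 / \<omega> < \<theta>\<close>,
  which is the time step restriction on one cell (\<open>cell_update_admissible\<close>).

  All this rests on positive weights and on exactness of the two rules. Legendre polynomials given by
  Rodrigues' formula are orthogonal to lower degrees, by parts, and have all their zeros in
  \<open>(-1, 1)\<close>, by Rolle's theorem; from there both rules follow from a single statement on interpolatory rules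
  whose node polynomial is orthogonal to low degrees (\<open>interpolatory_quadrature\<close>).\<close>


section \<open>Integrals of polynomials\<close>

lemma poly_integrable_on [simp, intro]: "poly p integrable_on {a..b::real}"
  by (intro integrable_continuous_interval continuous_intros)

lemma integral_poly_0 [simp]: "integral A (poly 0) = (0::real)"
proof -
  have "poly 0 = (\<lambda>x. 0 :: real)" by auto
  then show ?thesis by simp
qed

lemma integral_poly_add:
  "integral {a..b} (poly (p + q)) = integral {a..b} (poly p) + integral {a..b::real} (poly q)"
  using integral_add[of "poly p" "{a..b}" "poly q"] by (simp flip: poly_add)

lemma integral_poly_smult:
  "integral {a..b} (poly (smult c p)) = c * integral {a..b::real} (poly p)"
  using integral_mult_right[of "{a..b}" c "poly p"] by (simp flip: poly_smult)

lemma integral_poly_pderiv: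
  fixes a b :: real
  assumes "a \<le> b"
  shows "integral {a..b} (poly (pderiv f)) = poly f b - poly f a"
proof -
  have "(poly (pderiv f) has_integral (poly f b - poly f a)) {a..b}"
    using assms
    by (intro fundamental_theorem_of_calculus)
       (auto simp flip: has_real_derivative_iff_has_vector_derivative
             intro: DERIV_subset[OF poly_DERIV])
  then show ?thesis by (rule integral_unique)
qed

lemma integral_poly_by_parts:
  fixes f :: "real poly"
  shows "integral {-1..1} (poly (pderiv f * q))
       = poly (f * q) 1 - poly (f * q) (-1) - integral {-1..1} (poly (f * pderiv q))"
proof -
  have "integral {-1..1} (poly (pderiv (f * q)))
      = integral {-1..1} (poly (pderiv f * q)) + integral {-1..1} (poly (f * pderiv q))"
    by (simp add: pderiv_mult integral_poly_add mult.commute)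
  then show ?thesis using integral_poly_pderiv[of "-1" 1 "f * q"] by simp
qed

lemma integral_poly_pos:
  assumes "\<And>t. t \<in> {-1..1} \<Longrightarrow> 0 \<le> poly g t" and "g \<noteq> 0"
  shows "0 < integral {-1..1::real} (poly g)"
proof (rule ccontr)
  assume "\<not> ?thesis"
  moreover have "integral {-1..1} (poly g) \<ge> 0"
    using assms(1) by (intro Henstock_Kurzweil_Integration.integral_nonneg) auto
  ultimately have "integral {-1..1} (poly g) = 0" by linarith
  then have 0: "(poly g has_integral 0) (cbox (-1) 1)"
    using integrable_integral[OF poly_integrable_on, of g "-1" 1] by simp
  have "poly g t = 0" if "t \<in> {-1..1}" for t
    by (rule has_integral_0_cbox_imp_0[OF _ _ 0]) (use that assms(1) in \<open>auto intro: continuous_intros\<close>)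
  then have "{-1..1} \<subseteq> {t. poly g t = 0}" by auto
  with poly_roots_finite[OF assms(2)] have "finite {-1..1::real}" by (rule finite_subset[rotated])
  then show False using infinite_Icc[of "-1" "1::real"] by simp
qed


section \<open>Interpolatory quadrature\<close>

lemma lagrange_interpolation:
  fixes X :: "real set"
  assumes "finite X" and "X \<noteq> {}" and "degree p < card X"
  shows "poly p t = (\<Sum>\<xi>\<in>X. poly p \<xi> * (\<Prod>\<eta>\<in>X - {\<xi>}. (t - \<eta>) / (\<xi> - \<eta>)))"
proof -
  define l where "l \<xi> = (\<Prod>\<eta>\<in>X - {\<xi>}. [:- \<eta> / (\<xi> - \<eta>), 1 / (\<xi> - \<eta>):])" for \<xi> :: real
  have l: "poly (l \<xi>) t = (\<Prod>\<eta>\<in>X - {\<xi>}. (t - \<eta>) / (\<xi> - \<eta>))" for \<xi> t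
    by (simp add: l_def poly_prod diff_divide_distrib) 
  have deg: "degree (l \<xi>) < card X" if "\<xi> \<in> X" for \<xi>
  proof -
    have "degree (l \<xi>) \<le> (\<Sum>\<eta>\<in>X - {\<xi>}. degree [:- \<eta> / (\<xi> - \<eta>), 1 / (\<xi> - \<eta>):])"
      unfolding l_def by (rule degree_prod_sum_le[unfolded o_def]) (use assms in auto)
    also have "\<dots> \<le> (\<Sum>\<eta>\<in>X - {\<xi>}. 1)" by (intro sum_mono) auto
    also have "\<dots> < card X"
      using that assms by (simp add: card_gt_0_iff)
    finally show ?thesis .
  qed
  have l_nodes: "poly (l \<xi>) \<zeta> = (if \<xi> = \<zeta> then 1 else 0)" if "\<zeta> \<in> X" for \<xi> \<zeta>
    using that assms(1) by (auto simp: l intro!: prod.neutral)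
  define s where "s = (\<Sum>\<xi>\<in>X. smult (poly p \<xi>) (l \<xi>))"
  have "p = s"
  proof (rule poly_eqI_degree[of X])
    show "poly p \<zeta> = poly s \<zeta>" if "\<zeta> \<in> X" for \<zeta>
      using that assms(1) by (simp add: s_def poly_sum l_nodes if_distrib[of "\<lambda>x. _ * x"] cong: if_cong)
    show "degree s < card X"
      unfolding s_def
      by (rule degree_sum_less) (use deg assms in \<open>auto simp: card_gt_0_iff intro: le_less_trans[OF degree_smult_le]\<close>)
  qed (use assms in auto)
  then have "poly p t = poly s t" by simp
  then show ?thesis by (simp add: s_def poly_sum l)
qed

text \<open>Division by the node polynomial leaves a remainder of degree below the number of nodes,
  which Lagrange interpolation integrates; the quotient is killed by orthogonality.\<close>

lemma interpolatory_quadrature: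
  fixes X :: "real set"
  assumes X: "finite X" "X \<noteq> {}"
    and \<omega>: "degree \<omega> = card X" "\<And>\<xi>. \<xi> \<in> X \<Longrightarrow> poly \<omega> \<xi> = 0"
    and orth: "\<And>q. degree q < d \<Longrightarrow> integral {-1..1} (poly (\<omega> * q)) = 0"
    and p: "degree p < card X + d"
  shows "integral {-1..1} (poly p) = 2 * (\<Sum>\<xi>\<in>X. interp_weight X \<xi> * poly p \<xi>)"
proof -
  define r where "r = p mod \<omega>"
  have cX: "card X > 0" using X by (simp add: card_gt_0_iff)
  have \<omega>0: "\<omega> \<noteq> 0" using \<omega>(1) cX by auto
  have p_eq: "p = \<omega> * (p div \<omega>) + r" by (simp add: r_def)
  have deg_r: "degree r < card X"
    using degree_mod_less[OF \<omega>0, of p] \<omega>(1) cX by (auto simp: r_def)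
  have zero: "integral {-1..1} (poly (\<omega> * (p div \<omega>))) = 0"
  proof (cases "p div \<omega> = 0")
    case False
    have "degree p = degree (\<omega> * (p div \<omega>))"
    proof -
      have "degree r < degree (\<omega> * (p div \<omega>))"
        using deg_r \<omega>(1) False \<omega>0 by (simp add: degree_mult_eq)
      then show ?thesis using p_eq by (metis degree_add_eq_left)
    qed
    then have "degree (p div \<omega>) < d"
      using p \<omega>(1) False \<omega>0 by (simp add: degree_mult_eq)
    then show ?thesis by (rule orth)
  qed simp
  have "integral {-1..1} (poly p) = integral {-1..1} (poly r)"
    by (subst p_eq) (simp only: integral_poly_add zero)
  also have "\<dots> = integral {-1..1}
      (\<lambda>t. \<Sum>\<xi>\<in>X. poly r \<xi> * (\<Prod>\<eta>\<in>X - {\<xi>}. (t - \<eta>) / (\<xi> - \<eta>)))"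
    by (rule integral_cong) (rule lagrange_interpolation[OF X deg_r])
  also have "\<dots> = (\<Sum>\<xi>\<in>X. integral {-1..1}
      (\<lambda>t. poly r \<xi> * (\<Prod>\<eta>\<in>X - {\<xi>}. (t - \<eta>) / (\<xi> - \<eta>))))"
    using X(1) by (intro integral_sum integrable_continuous_interval continuous_intros) auto
  also have "\<dots> = (\<Sum>\<xi>\<in>X. 2 * (interp_weight X \<xi> * poly r \<xi>))"
    by (simp add: interp_weight_def mult_ac)
  also have "\<dots> = 2 * (\<Sum>\<xi>\<in>X. interp_weight X \<xi> * poly p \<xi>)"
    unfolding sum_distrib_left
  proof (intro sum.cong refl)
    fix \<xi> assume "\<xi> \<in> X"
    then have "poly p \<xi> = poly r \<xi>" using \<omega>(2) by (subst p_eq) simp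
    then show "2 * (interp_weight X \<xi> * poly r \<xi>) = 2 * (interp_weight X \<xi> * poly p \<xi>)" by simp
  qed
  finally show ?thesis .
qed

text \<open>A nonnegative polynomial within the degree of exactness that vanishes at all other nodes
  isolates one weight.\<close>

lemma quadrature_weight_pos:
  fixes X :: "real set"
  assumes "finite X" and "\<xi> \<in> X" and "X \<subseteq> {-1..1}"
    and exact: "integral {-1..1} (poly g) = 2 * (\<Sum>\<eta>\<in>X. w \<eta> * poly g \<eta>)"
    and g: "\<And>t. t \<in> {-1..1} \<Longrightarrow> 0 \<le> poly g t" "g \<noteq> 0" "\<And>\<eta>. \<eta> \<in> X - {\<xi>} \<Longrightarrow> poly g \<eta> = 0"
  shows "w \<xi> > (0::real)"
proof -
  have "(\<Sum>\<eta>\<in>X. w \<eta> * poly g \<eta>) = w \<xi> * poly g \<xi>"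
    using assms by (subst sum.remove[of _ \<xi>]) auto
  then have "0 < w \<xi> * poly g \<xi>" using integral_poly_pos[OF g(1,2)] exact by simp
  moreover have "0 \<le> poly g \<xi>" using assms by blast
  ultimately show ?thesis by (simp add: zero_less_mult_iff)
qed

lemma interp_weight_reflect:
  assumes "uminus ` X = X"
  shows "interp_weight X (- \<xi>) = interp_weight X \<xi>"
proof -
  have "(\<Prod>\<eta>\<in>X - {- \<xi>}. (- t - \<eta>) / (- \<xi> - \<eta>)) = (\<Prod>\<eta>\<in>X - {\<xi>}. (t - \<eta>) / (\<xi> - \<eta>))" for t
  proof -
    have X: "X - {- \<xi>} = uminus ` (X - {\<xi>})"
      using assms by (subst image_set_diff) (auto simp: inj_on_def)
    have "(- t + \<eta>) / (- \<xi> + \<eta>) = (t - \<eta>) / (\<xi> - \<eta>)" for \<eta>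
      using minus_divide_divide[of "t - \<eta>" "\<xi> - \<eta>"] by (simp add: algebra_simps)
    then show ?thesis
      unfolding X by (subst prod.reindex) (auto simp: inj_on_def)
  qed
  then have "integral {-1..1} (\<lambda>t. \<Prod>\<eta>\<in>X - {\<xi>}. (t - \<eta>) / (\<xi> - \<eta>))
           = integral {- 1..- (- 1)} (\<lambda>t. \<Prod>\<eta>\<in>X - {- \<xi>}. (- t - \<eta>) / (- \<xi> - \<eta>))" by simp
  also have "\<dots> = integral {-1..1} (\<lambda>t. \<Prod>\<eta>\<in>X - {- \<xi>}. (t - \<eta>) / (- \<xi> - \<eta>))"
    using Henstock_Kurzweil_Integration.integral_reflect_real[of 1 "-1" "\<lambda>t. \<Prod>\<eta>\<in>X - {- \<xi>}. (t - \<eta>) / (- \<xi> - \<eta>)"] by simp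
  finally show ?thesis by (simp add: interp_weight_def)
qed


section \<open>Legendre polynomials\<close>

lemma degree_pderiv_funpow: "degree ((pderiv ^^ j) p) = degree (p :: real poly) - j"
  by (induction j) (auto simp: degree_pderiv)

text \<open>The polynomial whose \<open>n\<close>-th derivative is, up to a factor, the Legendre polynomial.\<close>

abbreviation rodrigues :: "nat \<Rightarrow> real poly" where
  "rodrigues n \<equiv> [:-1, 0, 1:] ^ n"

lemma degree_rodrigues: "degree (rodrigues n) = 2 * n"
  by (simp add: degree_power_eq)

lemma power_dvd_pderiv:
  fixes p :: "real poly"
  assumes "[:-a, 1:] ^ Suc m dvd p"
  shows "[:-a, 1:] ^ m dvd pderiv p"
proof -
  define X where "X = [:-a, 1:]"
  have dX: "pderiv X = 1" by (simp add: X_def pderiv_pCons)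
  obtain q where "p = X ^ Suc m * q" using assms unfolding X_def by (rule dvdE)
  then have "pderiv p = X ^ m * (X * pderiv q + smult (1 + real m) q)"
    by (simp only: pderiv_mult pderiv_power_Suc dX) (simp add: algebra_simps smult_add_left)
  then show ?thesis unfolding X_def by (rule dvdI)
qed

text \<open>Each differentiation lowers the order of the zeros of \<open>(\<xi>\<^sup>2 - 1)\<^sup>n\<close> at \<open>\<plusminus>1\<close> by at most one.\<close>

lemma pderiv_rodrigues_endpoints:
  assumes "j < n" and "a \<in> {-1, 1}"
  shows "poly ((pderiv ^^ j) (rodrigues n)) a = 0"
proof -
  have "rodrigues n = [:-1, 1:] ^ n * [:1, 1:] ^ n"
    by (simp flip: power_mult_distrib)
  then have "[:-a, 1:] ^ n dvd rodrigues n" using assms(2) by auto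
  then have "[:-a, 1:] ^ (n - i) dvd (pderiv ^^ i) (rodrigues n)" if "i \<le> n" for i
    using that
  proof (induction i)
    case (Suc i)
    then show ?case using power_dvd_pderiv[of a "n - Suc i"] by (simp add: Suc_diff_Suc)
  qed simp
  from this[of j] assms(1) have "[:-a, 1:] dvd (pderiv ^^ j) (rodrigues n)"
    by (metis dvd_power dvd_trans less_imp_le zero_less_diff)
  then show ?thesis by (simp add: poly_eq_0_iff_dvd)
qed

text \<open>Repeated integration by parts; the boundary terms vanish.\<close>

lemma pderiv_rodrigues_orthogonal:
  assumes "m \<le> n" and "degree q < m"
  shows "integral {-1..1} (poly ((pderiv ^^ m) (rodrigues n) * q)) = 0"
  using assms
proof (induction m arbitrary: q)
  case (Suc m)
  have "integral {-1..1} (poly ((pderiv ^^ m) (rodrigues n) * pderiv q)) = 0"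
  proof (cases "degree q = 0")
    case True
    then have "pderiv q = 0" by (simp add: pderiv_eq_0_iff)
    then show ?thesis by simp
  next
    case False
    then show ?thesis using Suc by (intro Suc.IH) (auto simp: degree_pderiv)
  qed
  then show ?case
    using Suc.prems pderiv_rodrigues_endpoints[of m n]
    by (simp add: integral_poly_by_parts del: poly_mult) simp
qed simp

lemma legendre_orthogonal:
  assumes "degree q < n"
  shows "integral {-1..1} (poly (legendre n * q)) = 0"
  using pderiv_rodrigues_orthogonal[OF order_refl assms]
  by (simp add: legendre_def integral_poly_smult)

lemma degree_legendre: "degree (legendre n) = n"
  by (simp add: legendre_def degree_pderiv_funpow degree_rodrigues)

lemma legendre_nonzero: "legendre n \<noteq> 0"
  by (metis degree_0 degree_legendre legendre_0 one_neq_zero)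

text \<open>\<open>(\<xi>\<^sup>2 - 1)\<^sup>n\<close> is even, and each derivative switches the parity.\<close>

lemma legendre_parity: "poly (legendre n) (- t) = (-1) ^ n * poly (legendre n) t"
proof -
  define \<sigma> where "\<sigma> = [:0, -1::real:]"
  have "pcompose ((pderiv ^^ j) (rodrigues n)) \<sigma> = smult ((-1) ^ j) ((pderiv ^^ j) (rodrigues n))" for j
  proof (induction j)
    case 0
    have "pcompose (rodrigues n) \<sigma> = rodrigues n"
      by (induction n) (simp_all add: pcompose_mult \<sigma>_def pcompose_pCons pcompose_1 del: mult_pCons_left)
    then show ?case by simp
  next
    case (Suc j)
    have "pderiv (pcompose ((pderiv ^^ j) (rodrigues n)) \<sigma>)
        = - pcompose ((pderiv ^^ Suc j) (rodrigues n)) \<sigma>"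
      by (simp add: pderiv_pcompose \<sigma>_def pderiv_pCons)
    with Suc show ?case by (simp add: pderiv_smult minus_equation_iff)
  qed
  from arg_cong[OF this[of n], of "\<lambda>p. poly p t"] show ?thesis
    by (simp add: legendre_def poly_pcompose \<sigma>_def)
qed

text \<open>Rolle's theorem between consecutive zeros.\<close>

lemma poly_rolle_card:
  fixes S :: "real set"
  assumes "finite S" and "S \<noteq> {}" and "\<And>s. s \<in> S \<Longrightarrow> poly p s = 0"
  shows "\<exists>T. finite T \<and> T \<subseteq> {Min S<..<Max S} \<and> Suc (card T) = card S \<and>
    (\<forall>t\<in>T. poly (pderiv p) t = 0)"
  using assms
proof (induction S rule: finite_linorder_max_induct)
  case (insert b A)
  show ?case
  proof (cases "A = {}")
    case True
    then show ?thesis by (intro exI[of _ "{}"]) auto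
  next
    case False
    with insert obtain T where T: "finite T" "T \<subseteq> {Min A<..<Max A}" "Suc (card T) = card A"
        "\<forall>t\<in>T. poly (pderiv p) t = 0"
      by auto
    have "Max A < b" using insert False by auto
    moreover have "poly p (Max A) = poly p b" using insert False by simp
    ultimately obtain z where z: "Max A < z" "z < b" "poly (pderiv p) z = 0"
      using poly_MVT[of "Max A" b p] by auto
    have "Min A \<le> Max A" using insert(1) False by simp
    then have mm: "Min (insert b A) = Min A" "Max (insert b A) = b"
      using insert(1) False \<open>Max A < b\<close>
      by (simp_all add: Min_insert Max_insert min_absorb2 max_absorb1 del: Min_le_iff Max_ge_iff)
    have "z \<notin> T" using T z by force
    moreover have "b \<notin> A" using insert(2) by blast
    moreover have "T \<subseteq> {Min A<..<b}" using T(2) \<open>Max A < b\<close> by fastforce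
    moreover have "z \<in> {Min A<..<b}" using z \<open>Min A \<le> Max A\<close> by simp
    ultimately show ?thesis
      unfolding mm using T z insert(1) by (intro exI[of _ "insert z T"]) simp
  qed
qed simp

text \<open>Rolle's theorem adds one zero per differentiation, because the endpoints \<open>\<plusminus>1\<close> stay zeros
  until the last step.\<close>

lemma pderiv_rodrigues_zeros:
  assumes "j \<le> n"
  shows "\<exists>T. finite T \<and> T \<subseteq> {-1<..<1} \<and> card T = j \<and>
    (\<forall>t\<in>T. poly ((pderiv ^^ j) (rodrigues n)) t = 0)"
  using assms
proof (induction j)
  case (Suc j)
  then obtain T where T: "finite T" "T \<subseteq> {-1<..<1}" "card T = j"
      "\<forall>t\<in>T. poly ((pderiv ^^ j) (rodrigues n)) t = 0" by auto
  define S where "S = insert (-1) (insert 1 T)"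
  have S: "finite S" "S \<noteq> {}" "card S = Suc (Suc j)"
    using T by (auto simp: S_def card_insert_if)
  have "poly ((pderiv ^^ j) (rodrigues n)) s = 0" if "s \<in> S" for s
    using that T(4) pderiv_rodrigues_endpoints[of j n] Suc.prems by (auto simp: S_def)
  from poly_rolle_card[OF S(1,2) this] obtain T' where
    T': "finite T'" "T' \<subseteq> {Min S<..<Max S}" "Suc (card T') = card S"
      "\<forall>t\<in>T'. poly (pderiv ((pderiv ^^ j) (rodrigues n))) t = 0" by auto
  have "Min S \<in> S" "Max S \<in> S" using S by auto
  then have "Min S \<ge> -1" "Max S \<le> 1" using T(2) by (auto simp: S_def)
  then have "T' \<subseteq> {-1<..<1}" using T'(2) by (meson greaterThanLessThan_subseteq_greaterThanLessThan order_trans)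
  then show ?case using T' S by (intro exI[of _ T']) auto
qed auto

lemma poly_all_zeros:
  fixes p :: "real poly"
  assumes "p \<noteq> 0" and "\<And>t. t \<in> T \<Longrightarrow> poly p t = 0" and "card T = degree p"
  shows "{t. poly p t = 0} = T"
  using assms card_poly_roots_bound[of p] poly_roots_finite[of p]
  by (intro card_seteq[symmetric]) auto

lemma gauss_nodes_props:
  shows finite_gauss_nodes: "finite (gauss_nodes N)"
    and gauss_nodes_interior: "gauss_nodes N \<subseteq> {-1<..<1}"
    and card_gauss_nodes: "card (gauss_nodes N) = N"
proof -
  obtain T where T: "finite T" "T \<subseteq> {-1<..<1}" "card T = N"
      "\<forall>t\<in>T. poly ((pderiv ^^ N) (rodrigues N)) t = 0"
    using pderiv_rodrigues_zeros[of N N] by auto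
  have "gauss_nodes N = T"
    unfolding gauss_nodes_def
    by (rule poly_all_zeros) (use T degree_legendre legendre_nonzero in \<open>auto simp: legendre_def\<close>)
  with T show "finite (gauss_nodes N)" "gauss_nodes N \<subseteq> {-1<..<1}" "card (gauss_nodes N) = N"
    by auto
qed

lemma pderiv_legendre_zeros:
  fixes n defines "Z \<equiv> {\<xi>. poly (pderiv (legendre n)) \<xi> = 0}"
  assumes "n \<ge> 1"
  shows "finite Z" "Z \<subseteq> {-1<..<1}" "card Z = n - 1"
proof -
  have "gauss_nodes n \<noteq> {}" using card_gauss_nodes[of n] assms(2) by auto
  moreover have "poly (legendre n) s = 0" if "s \<in> gauss_nodes n" for s
    using that by (simp add: gauss_nodes_def)
  ultimately obtain T where T: "finite T" "T \<subseteq> {Min (gauss_nodes n)<..<Max (gauss_nodes n)}"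
      "Suc (card T) = n" "\<forall>t\<in>T. poly (pderiv (legendre n)) t = 0"
    using poly_rolle_card[OF finite_gauss_nodes, of n "legendre n"] card_gauss_nodes by auto
  have "Min (gauss_nodes n) \<in> {-1<..<1}" "Max (gauss_nodes n) \<in> {-1<..<1}"
    using \<open>gauss_nodes n \<noteq> {}\<close> finite_gauss_nodes gauss_nodes_interior[of n] Min_in Max_in by blast+
  then have "T \<subseteq> {-1<..<1}" using T(2) by auto
  moreover have "Z = T"
    unfolding Z_def
  proof (rule poly_all_zeros)
    show "pderiv (legendre n) \<noteq> 0"
      using assms(2) by (simp add: pderiv_eq_0_iff degree_legendre)
    show "card T = degree (pderiv (legendre n))"
      using T(3) by (auto simp: degree_pderiv degree_legendre)
  qed (use T in auto)
  ultimately show "finite Z" "Z \<subseteq> {-1<..<1}" "card Z = n - 1" using T by auto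
qed


section \<open>Gauss and Gauss--Lobatto rules\<close>

lemma gauss_exact:
  assumes "N \<ge> 1" and "degree p < 2 * N"
  shows "integral {-1..1} (poly p) = 2 * (\<Sum>\<xi>\<in>gauss_nodes N. gauss_weight N \<xi> * poly p \<xi>)"
  unfolding gauss_weight_def
proof (rule interpolatory_quadrature[where \<omega> = "legendre N" and d = N])
  show "gauss_nodes N \<noteq> {}" using card_gauss_nodes[of N] assms(1) by auto
  show "integral {-1..1} (poly (legendre N * q)) = 0" if "degree q < N" for q
    using that by (rule legendre_orthogonal)
  show "poly (legendre N) \<xi> = 0" if "\<xi> \<in> gauss_nodes N" for \<xi>
    using that by (simp add: gauss_nodes_def)
  show "degree (legendre N) = card (gauss_nodes N)"
    by (simp only: degree_legendre card_gauss_nodes)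
  show "degree p < card (gauss_nodes N) + N"
    using assms(2) by (simp only: card_gauss_nodes)
qed (rule finite_gauss_nodes)

text \<open>The test polynomial is the square of the product over the remaining nodes.\<close>

lemma gauss_weight_pos:
  assumes "\<xi> \<in> gauss_nodes N"
  shows "gauss_weight N \<xi> > 0"
proof -
  have N: "N \<ge> 1"
    using assms card_gauss_nodes[of N] finite_gauss_nodes[of N] by (cases N) auto
  define h where "h = (\<Prod>\<eta>\<in>gauss_nodes N - {\<xi>}. [:- \<eta>, 1:])"
  have "h \<noteq> 0" using finite_gauss_nodes by (auto simp: h_def)
  have "degree h = N - 1"
    using assms finite_gauss_nodes by (simp add: h_def degree_prod_sum_eq card_gauss_nodes)
  then have "degree (h ^ 2) < 2 * N"
    using N \<open>h \<noteq> 0\<close> by (simp add: degree_power_eq)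
  show ?thesis
  proof (rule quadrature_weight_pos[OF finite_gauss_nodes assms])
    show "integral {-1..1} (poly (h\<^sup>2)) =
        2 * (\<Sum>\<xi>\<in>gauss_nodes N. gauss_weight N \<xi> * poly (h\<^sup>2) \<xi>)"
      by (rule gauss_exact) fact+
    show "gauss_nodes N \<subseteq> {-1..1}"
      using gauss_nodes_interior[of N] by (rule order_trans) auto
    show "poly (h\<^sup>2) \<eta> = 0" if "\<eta> \<in> gauss_nodes N - {\<xi>}" for \<eta>
      using that finite_gauss_nodes[of N] by (auto simp: h_def poly_prod)
    show "0 \<le> poly (h\<^sup>2) t" for t by simp
    show "h\<^sup>2 \<noteq> 0" using \<open>h \<noteq> 0\<close> by simp
  qed
qed

context
  fixes L :: nat
  assumes L: "L \<ge> 2"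
begin

abbreviation (input) "inner_nodes \<equiv> {\<xi>. poly (pderiv (legendre (L - 1))) \<xi> = 0}"

lemma inner_nodes:
  shows "finite inner_nodes" "inner_nodes \<subseteq> {-1<..<1}" "card inner_nodes = L - 2"
  using pderiv_legendre_zeros[of "L - 1"] L by auto

lemma lobatto_nodes_props:
  shows finite_lobatto_nodes: "finite (lobatto_nodes L)"
    and lobatto_nodes_bounds: "lobatto_nodes L \<subseteq> {-1..1}"
    and card_lobatto_nodes: "card (lobatto_nodes L) = L"
proof -
  show "finite (lobatto_nodes L)" using inner_nodes by (simp add: lobatto_nodes_def)
  show "lobatto_nodes L \<subseteq> {-1..1}"
    using inner_nodes(2) by (auto simp: lobatto_nodes_def subset_iff less_imp_le)
  have "card (lobatto_nodes L) = card {-1, 1 :: real} + card inner_nodes"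
    unfolding lobatto_nodes_def
    by (rule card_Un_disjoint) (use inner_nodes in auto)
  then show "card (lobatto_nodes L) = L" using inner_nodes(3) L by simp
qed

text \<open>The node polynomial \<open>(\<xi>\<^sup>2 - 1) P'\<close>, with \<open>P\<close> the Legendre polynomial of degree \<open>L - 1\<close>, is
  orthogonal to degree \<open>< L - 2\<close>: integration by parts moves the derivative to
  \<open>(\<xi>\<^sup>2 - 1) q\<close>, which vanishes at \<open>\<plusminus>1\<close>.\<close>

lemma lobatto_exact:
  assumes "degree p < 2 * L - 2"
  shows "integral {-1..1} (poly p) = 2 * (\<Sum>\<xi>\<in>lobatto_nodes L. lobatto_weight L \<xi> * poly p \<xi>)"
  unfolding lobatto_weight_def
proof (rule interpolatory_quadrature[where \<omega> = "[:-1, 0, 1:] * pderiv (legendre (L - 1))" and d = "L - 2"])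
  have P': "pderiv (legendre (L - 1)) \<noteq> 0"
    using L by (simp add: pderiv_eq_0_iff degree_legendre)
  show "degree ([:-1, 0, 1:] * pderiv (legendre (L - 1))) = card (lobatto_nodes L)"
    using L P' by (simp add: degree_mult_eq card_lobatto_nodes degree_pderiv degree_legendre
        del: mult_pCons_left)
  show "poly ([:-1, 0, 1:] * pderiv (legendre (L - 1))) \<xi> = 0" if "\<xi> \<in> lobatto_nodes L" for \<xi>
    using that by (auto simp: lobatto_nodes_def)
  show "integral {-1..1} (poly ([:-1, 0, 1:] * pderiv (legendre (L - 1)) * q)) = 0"
    if "degree q < L - 2" for q
  proof -
    have "degree ([:-1, 0, 1:] * q) \<le> 2 + degree q"
      using degree_mult_le[of "[:-1, 0, 1::real:]" q] by (simp del: mult_pCons_left)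
    then have "degree (pderiv ([:-1, 0, 1:] * q)) < L - 1"
      using that by (simp add: degree_pderiv del: mult_pCons_left)
    from legendre_orthogonal[OF this]
    have "integral {-1..1} (poly (pderiv (legendre (L - 1)) * ([:-1, 0, 1:] * q))) = 0"
      by (subst integral_poly_by_parts) (simp del: mult_pCons_left)
    then show ?thesis by (simp add: mult_ac del: mult_pCons_left mult_pCons_right)
  qed
  show "degree p < card (lobatto_nodes L) + (L - 2)"
    using assms L by (simp add: card_lobatto_nodes)
  show "lobatto_nodes L \<noteq> {}" by (simp add: lobatto_nodes_def)
qed (rule finite_lobatto_nodes)

text \<open>The test polynomials are \<open>1 - t\<^sup>2\<close> or \<open>1 \<plusminus> t\<close> times the square of the product over the
  remaining inner nodes: a square of all remaining factors would exceed the degree of exactness.\<close>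

lemma lobatto_weight_pos:
  assumes "\<xi> \<in> lobatto_nodes L"
  shows "lobatto_weight L \<xi> > 0"
proof -
  define h where "h = (\<Prod>\<eta>\<in>inner_nodes - {\<xi>}. [:- \<eta>, 1:])"
  have h0: "h \<noteq> 0" using inner_nodes by (auto simp: h_def)
  have deg_h: "degree h = card (inner_nodes - {\<xi>})"
    by (simp add: h_def degree_prod_sum_eq)
  have h_zero: "poly h \<eta> = 0" if "\<eta> \<in> inner_nodes - {\<xi>}" for \<eta>
    using that inner_nodes(1) by (auto simp: h_def poly_prod)
  define e where "e = (if \<xi> = 1 then [:1, 1:] else if \<xi> = -1 then [:1, -1:] else [:1, 0, -1::real:])"
  have e0: "e \<noteq> 0" by (simp add: e_def)
  have e_pos: "poly e t \<ge> 0" if "t \<in> {-1..1}" for t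
    using that mult_left_mono[of t 1 "1 + t"] by (auto simp: e_def algebra_simps abs_square_le_1 simp flip: power2_eq_square)
  have e_zero: "poly e \<eta> = 0" if "\<eta> \<in> {-1, 1} - {\<xi>}" for \<eta>
    using that by (auto simp: e_def)
  have "degree (e * h ^ 2) = degree e + 2 * card (inner_nodes - {\<xi>})"
    using e0 h0 by (simp add: degree_mult_eq degree_power_eq deg_h)
  also have "\<dots> < 2 * L - 2"
  proof (cases "\<xi> \<in> {-1, 1}")
    case True
    then have "degree e = 1" by (auto simp: e_def)
    moreover have "inner_nodes - {\<xi>} = inner_nodes" using inner_nodes(2) True by auto
    ultimately show ?thesis using inner_nodes(3) L by simp
  next
    case False
    then have "\<xi> \<in> inner_nodes" using assms by (auto simp: lobatto_nodes_def)
    then have "card (inner_nodes - {\<xi>}) + 1 = L - 2"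
      using inner_nodes by (metis Suc_eq_plus1 card.remove)
    then show ?thesis using False by (simp add: e_def)
  qed
  finally have exact: "integral {-1..1} (poly (e * h ^ 2)) =
      2 * (\<Sum>\<xi>\<in>lobatto_nodes L. lobatto_weight L \<xi> * poly (e * h ^ 2) \<xi>)"
    by (rule lobatto_exact)
  show ?thesis
  proof (rule quadrature_weight_pos[OF finite_lobatto_nodes assms lobatto_nodes_bounds exact])
    show "poly (e * h ^ 2) \<eta> = 0" if "\<eta> \<in> lobatto_nodes L - {\<xi>}" for \<eta>
      using that e_zero h_zero by (auto simp: lobatto_nodes_def)
  qed (use e0 h0 e_pos in auto)
qed

text \<open>Legendre polynomials are even or odd, so that the nodes are symmetric about 0.\<close>

lemma lobatto_end_weights_equal: "lobatto_weight L 1 = lobatto_weight L (-1)"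
proof -
  have "poly (pderiv (legendre (L - 1))) (- t) = 0 \<longleftrightarrow> poly (pderiv (legendre (L - 1))) t = 0" for t
  proof -
    have "pcompose (legendre (L - 1)) [:0, -1:] = smult ((-1) ^ (L - 1)) (legendre (L - 1))"
      by (rule poly_eq_poly_eq_iff[THEN iffD1]) (auto simp: poly_pcompose legendre_parity)
    from arg_cong[OF this, of "\<lambda>p. poly (pderiv p) t"] show ?thesis
      by (auto simp: pderiv_pcompose pderiv_smult pderiv_pCons poly_pcompose)
  qed
  then have "uminus ` lobatto_nodes L = lobatto_nodes L"
    by (force simp: lobatto_nodes_def image_Un image_iff)
  from interp_weight_reflect[OF this, of 1] show ?thesis by (simp add: lobatto_weight_def)
qed

end

lemma lobatto_size_props: "lobatto_size k \<ge> 2" "k < 2 * lobatto_size k - 2"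
proof -
  have "real_of_int \<lceil>(real k + 3) / 2\<rceil> \<ge> (real k + 3) / 2" by simp
  then have "real (lobatto_size k) \<ge> (real k + 3) / 2" unfolding lobatto_size_def by linarith
  then show "lobatto_size k \<ge> 2" "k < 2 * lobatto_size k - 2" by simp_all
qed


section \<open>The admissible set\<close>

lemma source_vec_nth [simp]:
  "source_vec U $ 1 = 0" "source_vec U $ 2 = U $ 1" "source_vec U $ 3 = U $ 2"
  by (simp_all add: source_vec_def vector_3)

lemma flux_nth [simp]:
  "flux \<gamma> U $ 1 = U $ 1 * velocity U"
  "flux \<gamma> U $ 2 = U $ 1 * (velocity U)\<^sup>2 + pressure \<gamma> U"
  "flux \<gamma> U $ 3 = (U $ 3 + pressure \<gamma> U) * velocity U"
  by (simp_all add: flux_def vector_3)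

lemma admissible_scaleR:
  assumes "U \<in> admissible \<gamma>" and "c > 0"
  shows "c *\<^sub>R U \<in> admissible \<gamma>"
proof -
  have "pressure \<gamma> (c *\<^sub>R U) = c * pressure \<gamma> U"
    using assms by (simp add: pressure_def power_mult_distrib power2_eq_square field_simps)
  with assms show ?thesis by (simp add: admissible_def)
qed

text \<open>Superadditivity of the pressure amounts to the convexity of the kinetic energy
  \<open>m\<^sup>2 / (2 \<rho>)\<close>, which is homogeneous of degree 1.\<close>

lemma admissible_add:
  assumes "\<gamma> > 1" and U: "U \<in> admissible \<gamma>" and V: "V \<in> admissible \<gamma>"
  shows "U + V \<in> admissible \<gamma>"
proof -
  define r s m n where rs: "r = U $ 1" "s = V $ 1" "m = U $ 2" "n = V $ 2"
  have pos: "r > 0" "s > 0" using U V by (auto simp: rs admissible_def)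
  have "m\<^sup>2 / (2 * r) + n\<^sup>2 / (2 * s) - (m + n)\<^sup>2 / (2 * (r + s))
      = (m * s - n * r)\<^sup>2 / (2 * r * s * (r + s))"
    using pos by (simp add: divide_simps) (simp add: power2_eq_square algebra_simps)
  also have "\<dots> \<ge> 0" using pos by simp
  finally have "m\<^sup>2 / (2 * r) + n\<^sup>2 / (2 * s) \<ge> (m + n)\<^sup>2 / (2 * (r + s))" by simp
  then have "(\<gamma> - 1) * ((U $ 3 - m\<^sup>2 / (2 * r)) + (V $ 3 - n\<^sup>2 / (2 * s)))
      \<le> (\<gamma> - 1) * (U $ 3 + V $ 3 - (m + n)\<^sup>2 / (2 * (r + s)))"
    using assms(1) by (intro mult_left_mono) auto
  then have "pressure \<gamma> U + pressure \<gamma> V \<le> pressure \<gamma> (U + V)"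
    by (simp add: pressure_def rs distrib_left)
  with U V show ?thesis by (auto simp: admissible_def)
qed

lemma admissible_sum:
  assumes "\<gamma> > 1" and "finite Z" and "Z \<noteq> {}" and "\<And>z. z \<in> Z \<Longrightarrow> V z \<in> admissible \<gamma>"
  shows "(\<Sum>z\<in>Z. V z) \<in> admissible \<gamma>"
  using assms(2-4) by (induction Z rule: finite_ne_induct) (auto intro: admissible_add assms(1))

lemma wave_speed_nonneg: "\<gamma> > 1 \<Longrightarrow> U \<in> admissible \<gamma> \<Longrightarrow> wave_speed \<gamma> U \<ge> 0"
  by (simp add: wave_speed_def admissible_def)

text \<open>The pressure of \<open>U + a Q(U)\<close> is \<open>p - (\<gamma> - 1) a\<^sup>2 \<rho> / 2\<close>: the work done by the
  force cancels against the change of the kinetic energy to first order.\<close>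

lemma admissible_source:
  assumes "\<gamma> > 1" and U: "U \<in> admissible \<gamma>"
    and a: "\<bar>a\<bar> * sqrt ((\<gamma> - 1) * U $ 1 / (2 * pressure \<gamma> U)) < 1"
  shows "U + a *\<^sub>R source_vec U \<in> admissible \<gamma>"
proof -
  have pos: "U $ 1 > 0" "pressure \<gamma> U > 0" using U by (auto simp: admissible_def)
  have "(\<bar>a\<bar> * sqrt ((\<gamma> - 1) * U $ 1 / (2 * pressure \<gamma> U)))\<^sup>2 < 1"
    using a assms(1) pos by (intro power_less_one_iff[THEN iffD2]) auto
  then have "a\<^sup>2 * ((\<gamma> - 1) * U $ 1 / (2 * pressure \<gamma> U)) < 1"
    using assms(1) pos by (simp add: power_mult_distrib)
  then have "(\<gamma> - 1) * a\<^sup>2 * U $ 1 / 2 < pressure \<gamma> U"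
    using pos by (simp add: field_simps)
  moreover have "pressure \<gamma> (U + a *\<^sub>R source_vec U) = pressure \<gamma> U - (\<gamma> - 1) * a\<^sup>2 * U $ 1 / 2"
    using pos by (simp add: pressure_def field_simps power2_eq_square)
  ultimately show ?thesis using pos by (simp add: admissible_def)
qed

text \<open>With \<open>v = 1 - a u\<close> the density of \<open>U - a F(U)\<close> is \<open>\<rho> v\<close> and its internal energy is
  \<open>p v / (\<gamma> - 1) - a\<^sup>2 p\<^sup>2 / (2 \<rho> v)\<close>. Both are positive if \<open>v > \<bar>a\<bar> c\<close> with the sound speed
  \<open>c\<close>, as \<open>c\<^sup>2 = \<gamma> p / \<rho>\<close> exceeds \<open>(\<gamma> - 1) p / (2 \<rho>)\<close>.\<close>

lemma admissible_flux:
  assumes "\<gamma> > 1" and U: "U \<in> admissible \<gamma>" and a: "\<bar>a\<bar> * wave_speed \<gamma> U < 1"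
  shows "U - a *\<^sub>R flux \<gamma> U \<in> admissible \<gamma>"
proof -
  define r m u p v where d: "r = U $ 1" "m = U $ 2" "u = velocity U" "p = pressure \<gamma> U" "v = 1 - a * u"
  have pos: "r > 0" "p > 0" using U by (auto simp: d admissible_def)
  have m: "U $ 2 = r * u" using pos by (simp add: d velocity_def)
  have E: "U $ 3 = p / (\<gamma> - 1) + r * u\<^sup>2 / 2"
    using assms(1) pos(1) by (simp add: d velocity_def pressure_def field_simps power2_eq_square)
  have "\<bar>a\<bar> * \<bar>u\<bar> + \<bar>a\<bar> * sqrt (\<gamma> * p / r) < 1"
    using a by (simp add: wave_speed_def d distrib_left)
  moreover have "a * u \<le> \<bar>a\<bar> * \<bar>u\<bar>" by (metis abs_ge_self abs_mult)
  ultimately have v: "\<bar>a\<bar> * sqrt (\<gamma> * p / r) < v" by (simp add: d(5))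
  have s0: "\<bar>a\<bar> * sqrt (\<gamma> * p / r) \<ge> 0" using pos assms(1) by simp
  with v have v0: "v > 0" by linarith
  have "(\<bar>a\<bar> * sqrt (\<gamma> * p / r))\<^sup>2 < v\<^sup>2"
    using v s0 by (intro power_strict_mono) auto
  then have "a\<^sup>2 * (\<gamma> * p / r) < v\<^sup>2"
    using assms(1) pos by (simp add: power_mult_distrib)
  then have *: "a\<^sup>2 * \<gamma> * p < v\<^sup>2 * r" using pos by (simp add: field_simps)
  have "(\<gamma> - 1) * (a\<^sup>2 * p) \<le> 2 * (\<gamma> * (a\<^sup>2 * p))"
    using assms(1) pos by (intro order_trans[OF mult_right_mono[of "\<gamma> - 1" "2 * \<gamma>"]]) auto
  with * have **: "(\<gamma> - 1) * a\<^sup>2 * p < 2 * v\<^sup>2 * r" by (simp add: mult_ac)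
  have p_eq: "pressure \<gamma> (U - a *\<^sub>R flux \<gamma> U) = p * v - (\<gamma> - 1) * a\<^sup>2 * p\<^sup>2 / (2 * r * v)"
  proof -
    have 1: "(U - a *\<^sub>R flux \<gamma> U) $ 1 = r * v" by (simp add: d algebra_simps)
    have 2: "(U - a *\<^sub>R flux \<gamma> U) $ 2 = r * u * v - a * p"
      using m by (simp add: d(1,3-5) algebra_simps power2_eq_square)
    have 3: "(U - a *\<^sub>R flux \<gamma> U) $ 3 = (p / (\<gamma> - 1) + r * u\<^sup>2 / 2) * v - a * p * u"
      using E by (simp add: d(3-5) algebra_simps add_divide_distrib diff_divide_distrib)
    have "(r * u * v - a * p)\<^sup>2 / (2 * (r * v)) = r * u\<^sup>2 * v / 2 - a * p * u + a\<^sup>2 * p\<^sup>2 / (2 * r * v)"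
      using pos v0 by (simp add: field_simps power2_eq_square)
    then have "pressure \<gamma> (U - a *\<^sub>R flux \<gamma> U)
        = (\<gamma> - 1) * (p / (\<gamma> - 1) * v - a\<^sup>2 * p\<^sup>2 / (2 * r * v))"
      by (simp add: pressure_def 1 2 3 algebra_simps del: vector_minus_component vector_scaleR_component)
    then show ?thesis using assms(1) by (simp add: right_diff_distrib)
  qed
  have "p * v - (\<gamma> - 1) * a\<^sup>2 * p\<^sup>2 / (2 * r * v)
      = p / (2 * r * v) * (2 * v\<^sup>2 * r - (\<gamma> - 1) * a\<^sup>2 * p)"
    using pos v0 by (simp add: field_simps power2_eq_square)
  also have "\<dots> > 0" using pos v0 ** by simp
  finally have "pressure \<gamma> (U - a *\<^sub>R flux \<gamma> U) > 0" by (simp add: p_eq)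
  moreover have "(U - a *\<^sub>R flux \<gamma> U) $ 1 > 0"
    using pos v0 by (simp add: d(1)) (simp add: d algebra_simps)
  ultimately show ?thesis by (simp add: admissible_def)
qed


section \<open>Splitting a discrete average\<close>

text \<open>The source acts node by node, so every node pays for its own force with its share \<open>\<eta>\<close>.\<close>

lemma admissible_average_with_source:
  assumes "\<gamma> > 1" and "finite Z" "Z \<noteq> {}" and "\<And>z. z \<in> Z \<Longrightarrow> W z > 0"
    and G: "\<And>z. z \<in> Z \<Longrightarrow> V z \<in> admissible \<gamma>" and "\<eta> > 0"
    and b: "\<And>z. z \<in> Z \<Longrightarrow> \<bar>b z\<bar> * sqrt ((\<gamma> - 1) * V z $ 1 / (2 * pressure \<gamma> (V z))) < \<eta>"
  shows "\<eta> *\<^sub>R (\<Sum>z\<in>Z. W z *\<^sub>R V z) + (\<Sum>z\<in>Z. (W z * b z) *\<^sub>R source_vec (V z)) \<in> admissible \<gamma>"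
proof -
  have "(\<Sum>z\<in>Z. (W z * \<eta>) *\<^sub>R (V z + (b z / \<eta>) *\<^sub>R source_vec (V z))) \<in> admissible \<gamma>"
  proof (intro admissible_sum assms(1-3))
    fix z assume z: "z \<in> Z"
    have "\<bar>b z / \<eta>\<bar> * sqrt ((\<gamma> - 1) * V z $ 1 / (2 * pressure \<gamma> (V z))) < 1"
      using b[OF z] \<open>\<eta> > 0\<close> by (simp add: field_simps)
    then show "(W z * \<eta>) *\<^sub>R (V z + (b z / \<eta>) *\<^sub>R source_vec (V z)) \<in> admissible \<gamma>"
      using assms z by (intro admissible_scaleR admissible_source) auto
  qed
  also have "(\<Sum>z\<in>Z. (W z * \<eta>) *\<^sub>R (V z + (b z / \<eta>) *\<^sub>R source_vec (V z)))
     = \<eta> *\<^sub>R (\<Sum>z\<in>Z. W z *\<^sub>R V z) + (\<Sum>z\<in>Z. (W z * b z) *\<^sub>R source_vec (V z))"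
    using \<open>\<eta> > 0\<close> by (simp add: scaleR_add_right sum.distrib scaleR_sum_right mult_ac)
  finally show ?thesis .
qed

text \<open>The flux difference only involves two of the nodes, which pay for it alone.\<close>

lemma admissible_average_with_flux:
  assumes "\<gamma> > 1" and "finite Z" and "\<And>z. z \<in> Z \<Longrightarrow> W z > 0"
    and G: "\<And>z. z \<in> Z \<Longrightarrow> V z \<in> admissible \<gamma>" and "\<beta> > 0" and "l \<ge> 0"
    and z: "z0 \<in> Z" "z1 \<in> Z" "z0 \<noteq> z1"
    and l: "l * wave_speed \<gamma> (V z0) < \<beta> * W z0" "l * wave_speed \<gamma> (V z1) < \<beta> * W z1"
  shows "\<beta> *\<^sub>R (\<Sum>z\<in>Z. W z *\<^sub>R V z) - l *\<^sub>R (flux \<gamma> (V z1) - flux \<gamma> (V z0)) \<in> admissible \<gamma>"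
proof -
  \<comment> \<open>The part of the flux difference charged to the node \<open>z\<close>.\<close>
  define a where "a z = (if z = z1 then l else 0) - (if z = z0 then l else 0)" for z
  have "(\<Sum>z\<in>Z. (\<beta> * W z) *\<^sub>R (V z - (a z / (\<beta> * W z)) *\<^sub>R flux \<gamma> (V z))) \<in> admissible \<gamma>"
  proof (intro admissible_sum assms(1,2))
    fix z assume "z \<in> Z"
    then have W: "\<beta> * W z > 0" using assms by simp
    have "\<bar>a z\<bar> * wave_speed \<gamma> (V z) < \<beta> * W z"
      using l z(3) W \<open>l \<ge> 0\<close> by (auto simp: a_def)
    then have "\<bar>a z / (\<beta> * W z)\<bar> * wave_speed \<gamma> (V z) < 1"
      using W by (simp add: abs_div_pos[symmetric] pos_divide_less_eq)
    then show "(\<beta> * W z) *\<^sub>R (V z - (a z / (\<beta> * W z)) *\<^sub>R flux \<gamma> (V z)) \<in> admissible \<gamma>"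
      using W G[OF \<open>z \<in> Z\<close>] assms(1) by (intro admissible_scaleR admissible_flux)
  qed (use z in auto)
  also have "(\<Sum>z\<in>Z. (\<beta> * W z) *\<^sub>R (V z - (a z / (\<beta> * W z)) *\<^sub>R flux \<gamma> (V z)))
      = (\<Sum>z\<in>Z. \<beta> *\<^sub>R (W z *\<^sub>R V z) - a z *\<^sub>R flux \<gamma> (V z))"
  proof (intro sum.cong refl)
    fix z assume "z \<in> Z"
    then have "\<beta> * W z \<noteq> 0" using assms(3,5) by (metis less_irrefl mult_pos_pos)
    then show "(\<beta> * W z) *\<^sub>R (V z - (a z / (\<beta> * W z)) *\<^sub>R flux \<gamma> (V z))
        = \<beta> *\<^sub>R (W z *\<^sub>R V z) - a z *\<^sub>R flux \<gamma> (V z)"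
      by (simp add: scaleR_diff_right)
  qed
  also have "\<dots> = \<beta> *\<^sub>R (\<Sum>z\<in>Z. W z *\<^sub>R V z) - (\<Sum>z\<in>Z. a z *\<^sub>R flux \<gamma> (V z))"
    by (simp add: sum_subtractf scaleR_sum_right)
  also have "(\<Sum>z\<in>Z. a z *\<^sub>R flux \<gamma> (V z)) = l *\<^sub>R (flux \<gamma> (V z1) - flux \<gamma> (V z0))"
  proof -
    have "(\<Sum>z\<in>Z. a z *\<^sub>R flux \<gamma> (V z)) =
      (\<Sum>z\<in>Z. if z = z1 then l *\<^sub>R flux \<gamma> (V z) else 0) - (\<Sum>z\<in>Z. if z = z0 then l *\<^sub>R flux \<gamma> (V z) else 0)"
      unfolding sum_subtractf[symmetric]
      by (intro sum.cong) (auto simp: a_def)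
    then show ?thesis using assms(2) z by (simp add: scaleR_diff_right)
  qed
  finally show ?thesis .
qed


section \<open>Quadrature on the mesh\<close>

definition quadrature_exact :: "real set \<Rightarrow> (real \<Rightarrow> real) \<Rightarrow> nat \<Rightarrow> bool" where
  "quadrature_exact X w k \<longleftrightarrow>
     finite X \<and> (\<forall>p. degree p \<le> k \<longrightarrow> integral {-1..1} (poly p) = 2 * (\<Sum>\<xi>\<in>X. w \<xi> * poly p \<xi>))"

lemma quadrature_exact_gauss: "N \<ge> k + 1 \<Longrightarrow> quadrature_exact (gauss_nodes N) (gauss_weight N) k"
  by (simp add: quadrature_exact_def finite_gauss_nodes gauss_exact)

lemma quadrature_exact_lobatto:
  "quadrature_exact (lobatto_nodes (lobatto_size k)) (lobatto_weight (lobatto_size k)) k"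
  using lobatto_size_props[of k]
  by (simp add: quadrature_exact_def finite_lobatto_nodes lobatto_exact)

lemma grid_step: "uniform_grid x dx \<Longrightarrow> x (i + 1) = x i + dx / 2"
  unfolding uniform_grid_def by (metis add.commute diff_add_cancel)

lemma grid_step': "uniform_grid x dx \<Longrightarrow> x (i - 1) = x i - dx / 2"
  using grid_step[of x dx "i - 1"] by simp

lemma half_node_grid: "uniform_grid x dx \<Longrightarrow> half_node x \<kappa> \<xi> = x \<kappa> + dx / 4 * (1 + \<xi>)"
  by (simp add: half_node_def grid_step) (simp add: field_simps)

lemma half_node_inside:
  assumes "uniform_grid x dx" and "\<xi> \<in> {-1<..<1}"
  shows "half_node x \<kappa> \<xi> \<in> {x \<kappa><..<x (\<kappa> + 1)}"
proof -
  have dx: "dx > 0" using assms(1) by (simp add: uniform_grid_def)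
  have "dx / 4 * (1 + \<xi>) > 0" using dx assms(2) by simp
  moreover have "dx / 4 * (1 + \<xi>) < dx / 4 * 2"
    using dx assms(2) by (intro mult_strict_left_mono) auto
  ultimately show ?thesis using assms(1) by (simp add: half_node_grid grid_step)
qed

lemma half_interval_quadrature:
  assumes grid: "uniform_grid x dx" and q: "quadrature_exact X w k" "degree p \<le> k"
  shows "(poly p has_integral dx / 2 * (\<Sum>\<xi>\<in>X. w \<xi> * poly p (half_node x \<kappa> \<xi>))) {x \<kappa>..x (\<kappa> + 1)}"
proof -
  have dx: "dx > 0" using grid by (simp add: uniform_grid_def)
  define \<sigma> where "\<sigma> = [:x \<kappa> + dx / 4, dx / 4:]"
  have \<sigma>: "poly \<sigma> \<xi> = half_node x \<kappa> \<xi>" for \<xi>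
    by (simp add: \<sigma>_def half_node_grid[OF grid] field_simps)
  define I where "I = integral {x \<kappa>..x (\<kappa> + 1)} (poly p)"
  have I: "(poly p has_integral I) (cbox (x \<kappa>) (x (\<kappa> + 1)))"
    unfolding I_def by (simp add: integrable_integral)
  have ends: "(x \<kappa> - (x \<kappa> + dx / 4)) /\<^sub>R (dx / 4) = -1"
      "(x (\<kappa> + 1) - (x \<kappa> + dx / 4)) /\<^sub>R (dx / 4) = 1"
    using dx by (simp_all add: grid_step[OF grid])
  have \<sigma>': "dx / 4 * t + (x \<kappa> + dx / 4) = poly \<sigma> t" for t
    by (simp add: \<sigma>_def)
  have "((\<lambda>t. poly p (poly \<sigma> t)) has_integral (I / (dx / 4))) {-1..1}"
    using has_integral_affinity'[OF I, of "dx / 4" "x \<kappa> + dx / 4",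
        unfolded ends, unfolded real_scaleR_def \<sigma>'] dx
    by (simp add: field_simps)
  then have "integral {-1..1} (poly (pcompose p \<sigma>)) = I / (dx / 4)"
    unfolding poly_pcompose[symmetric] by (rule integral_unique)
  moreover have "degree (pcompose p \<sigma>) \<le> k"
    using q(2) dx by (simp add: degree_pcompose \<sigma>_def)
  ultimately have "I / (dx / 4) = 2 * (\<Sum>\<xi>\<in>X. w \<xi> * poly p (half_node x \<kappa> \<xi>))"
    using q(1) by (simp add: quadrature_exact_def poly_pcompose \<sigma>)
  then have "I = dx / 2 * (\<Sum>\<xi>\<in>X. w \<xi> * poly p (half_node x \<kappa> \<xi>))"
    using dx by (simp add: field_simps)
  with I show ?thesis by simp
qed

definition polynomial3 :: "nat \<Rightarrow> (real \<Rightarrow> real^3) \<Rightarrow> bool" where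
  "polynomial3 k P \<longleftrightarrow> (\<forall>c. \<exists>q. degree q \<le> k \<and> (\<forall>y. P y $ c = poly q y))"

lemma has_integral_vec_nth:
  fixes f :: "real \<Rightarrow> real^'n"
  assumes "\<And>c. ((\<lambda>y. f y $ c) has_integral I $ c) S"
  shows "(f has_integral I) S"
  unfolding has_integral_componentwise_iff[of f]
  using assms by (auto simp: Basis_vec_def inner_axis)

lemma half_interval_quadrature3:
  assumes "uniform_grid x dx" and "quadrature_exact X w k" and "polynomial3 k P"
  shows "(P has_integral (dx / 2) *\<^sub>R (\<Sum>\<xi>\<in>X. w \<xi> *\<^sub>R P (half_node x \<kappa> \<xi>))) {x \<kappa>..x (\<kappa> + 1)}"
proof (rule has_integral_vec_nth)
  fix c
  obtain q where q: "degree q \<le> k" "\<And>y. P y $ c = poly q y"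
    using assms(3) unfolding polynomial3_def by metis
  show "((\<lambda>y. P y $ c) has_integral
      ((dx / 2) *\<^sub>R (\<Sum>\<xi>\<in>X. w \<xi> *\<^sub>R P (half_node x \<kappa> \<xi>))) $ c) {x \<kappa>..x (\<kappa> + 1)}"
    using half_interval_quadrature[OF assms(1,2) q(1), of \<kappa>] by (simp add: q(2))
qed

text \<open>A cell of one mesh sees a function of the other mesh as two polynomials, one on each half. The
  pairs \<open>(\<kappa>, \<xi>)\<close> index all nodes of the cell, so that averages become single sums.\<close>

lemma cell_avg_quadrature:
  assumes grid: "uniform_grid x dx" and q: "quadrature_exact X w k"
    and P: "\<And>\<kappa>. \<kappa> \<in> {i - 1, i} \<Longrightarrow> polynomial3 k (P \<kappa>)"
    and f: "\<And>\<kappa> y. \<kappa> \<in> {i - 1, i} \<Longrightarrow> y \<in> {x \<kappa><..<x (\<kappa> + 1)} \<Longrightarrow> f y = P \<kappa> y"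
  shows "cell_avg x dx i f =
    (\<Sum>(\<kappa>, \<xi>)\<in>{i - 1, i} \<times> X. (w \<xi> / 2) *\<^sub>R P \<kappa> (half_node x \<kappa> \<xi>))"
proof -
  have dx: "dx > 0" using grid by (simp add: uniform_grid_def)
  define S where "S \<kappa> = (\<Sum>\<xi>\<in>X. w \<xi> *\<^sub>R P \<kappa> (half_node x \<kappa> \<xi>))" for \<kappa>
  have half: "(f has_integral (dx / 2) *\<^sub>R S \<kappa>) {x \<kappa>..x (\<kappa> + 1)}" if "\<kappa> \<in> {i - 1, i}" for \<kappa>
    using has_integral_spike_interior[of "P \<kappa>" _ "x \<kappa>" "x (\<kappa> + 1)" f]
      half_interval_quadrature3[OF grid q P[OF that]] f[OF that]
    by (simp add: S_def)
  have "(f has_integral (dx / 2) *\<^sub>R S (i - 1) + (dx / 2) *\<^sub>R S i) {x (i - 1)..x (i + 1)}"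
    using half[of "i - 1"] half[of i] dx
    by (intro has_integral_combine[where c = "x i"]) (simp_all add: grid_step[OF grid] grid_step'[OF grid])
  then have "integral (cell x i) f = (dx / 2) *\<^sub>R S (i - 1) + (dx / 2) *\<^sub>R S i"
    unfolding cell_def
    by (intro integral_unique) (simp add: has_integral_open_interval[of f, unfolded box_real cbox_interval])
  then have "cell_avg x dx i f = (1 / 2) *\<^sub>R S (i - 1) + (1 / 2) *\<^sub>R S i"
    using dx by (simp add: cell_avg_def scaleR_add_right)
  then show ?thesis
    by (simp add: S_def sum.cartesian_product[symmetric] scaleR_sum_right)
qed

text \<open>Admissibility at the cell interfaces concerns one-sided limits, which are the values of the
  polynomial that represents the function on the cell.\<close>

lemma cell_value_closure:
  fixes P :: "real \<Rightarrow> 'a::t2_space"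
  assumes "uniform_grid x dx" and P: "continuous_on UNIV P"
    and f: "\<And>y. y \<in> cell x j \<Longrightarrow> f y = P y" and y: "y \<in> {x (j - 1)..x (j + 1)}"
  shows "cell_value x j f y = P y"
proof (cases "y \<in> cell x j")
  case False
  have "x (j - 1) < x (j + 1)"
    using assms(1) by (simp add: grid_step grid_step') (simp add: uniform_grid_def)
  moreover have "cell x j - {y} = cell x j" using False by simp
  ultimately have nontriv: "at y within cell x j \<noteq> bot"
    using y by (simp add: at_within_eq_bot_iff) (simp add: cell_def)
  have "(P \<longlongrightarrow> P y) (at y within cell x j)"
    using P by (meson continuous_on_def continuous_on_subset UNIV_I tendsto_within_subset top_greatest)
  then have "(f \<longlongrightarrow> P y) (at y within cell x j)"
    by (rule Lim_transform_within[where d = 1]) (auto simp: f)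
  with nontriv have "Lim (at y within cell x j) f = P y" by (rule tendsto_Lim)
  with False show ?thesis by (simp add: cell_value_def)
qed (simp add: cell_value_def f)

lemma polynomial3_continuous: "polynomial3 k P \<Longrightarrow> continuous_on UNIV P"
proof -
  assume "polynomial3 k P"
  then obtain q where "\<And>c y. P y $ c = poly (q c) y" unfolding polynomial3_def by metis
  then have "P = (\<lambda>y. \<chi> c. poly (q c) y)" by (simp add: vec_eq_iff fun_eq_iff)
  then show ?thesis by (auto intro!: continuous_intros continuous_on_vec_lambda)
qed

lemma pw_poly3_trace:
  assumes "f \<in> pw_poly3 x J k" and "j \<in> J"
  shows "\<exists>P. polynomial3 k P \<and> (\<forall>y\<in>cell x j. f y = P y)"
proof -
  have "\<forall>c. \<exists>q. degree q \<le> k \<and> (\<forall>y\<in>cell x j. f y $ c = poly q y)"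
    using assms by (auto simp: pw_poly3_def pw_poly_def)
  then obtain q where "\<And>c. degree (q c) \<le> k" "\<And>c y. y \<in> cell x j \<Longrightarrow> f y $ c = poly (q c) y"
    by metis
  then show ?thesis
    by (intro exI[of _ "\<lambda>y. \<chi> c. poly (q c) y"]) (auto simp: polynomial3_def vec_eq_iff)
qed

lemma polynomial3_source_vec: "polynomial3 k P \<Longrightarrow> polynomial3 k (\<lambda>y. source_vec (P y))"
  unfolding polynomial3_def forall_3 source_vec_nth
  by (metis degree_0 le0 poly_0)

lemma pw_poly_Lim:
  fixes q :: "real poly"
  assumes "x \<kappa> < x (\<kappa> + 1)" and "\<And>y. y \<in> {x \<kappa><..<x (\<kappa> + 1)} \<Longrightarrow> f y = poly q y"
  shows "Lim (at_right (x \<kappa>)) f = poly q (x \<kappa>)"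
    and "Lim (at_left (x (\<kappa> + 1))) f = poly q (x (\<kappa> + 1))"
proof -
  have lim: "(poly q \<longlongrightarrow> poly q y) (at y within S)" for y S
    using poly_isCont[of y q] unfolding isCont_def by (rule tendsto_within_subset) simp
  have "eventually (\<lambda>y. poly q y = f y) (at_right (x \<kappa>))"
    unfolding eventually_at_right[OF assms(1)] using assms by auto
  with lim have "(f \<longlongrightarrow> poly q (x \<kappa>)) (at_right (x \<kappa>))"
    by (rule Lim_transform_eventually)
  then show "Lim (at_right (x \<kappa>)) f = poly q (x \<kappa>)"
    by (intro tendsto_Lim) simp_all
  have "eventually (\<lambda>y. poly q y = f y) (at_left (x (\<kappa> + 1)))"
    unfolding eventually_at_left[OF assms(1)] using assms by auto
  with lim have "(f \<longlongrightarrow> poly q (x (\<kappa> + 1))) (at_left (x (\<kappa> + 1)))"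
    by (rule Lim_transform_eventually)
  then show "Lim (at_left (x (\<kappa> + 1))) f = poly q (x (\<kappa> + 1))"
    by (intro tendsto_Lim) simp_all
qed


section \<open>The update of one cell average\<close>

lemma half_subset_cell:
  assumes "uniform_grid x dx" and "j = \<kappa> \<or> j = \<kappa> + 1"
  shows "{x \<kappa><..<x (\<kappa> + 1)} \<subseteq> cell x j"
proof -
  have dx: "dx > 0" using assms(1) by (simp add: uniform_grid_def)
  have "x (\<kappa> - 1) \<le> x \<kappa>" "x (\<kappa> + 1) \<le> x (\<kappa> + 1 + 1)"
    using dx grid_step'[OF assms(1), of \<kappa>] grid_step[OF assms(1), of "\<kappa> + 1"] by simp_all
  then show ?thesis using assms(2) by (auto simp: cell_def)
qed

lemma center_in_cell: "uniform_grid x dx \<Longrightarrow> x j \<in> cell x j"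
  by (simp add: cell_def grid_step grid_step') (simp add: uniform_grid_def)

text \<open>The cell of the other mesh that contains the half \<open>\<kappa>\<close> of the cell \<open>i\<close>, meant for
  \<open>\<kappa> \<in> {i - 1, i}\<close>.\<close>

definition other_cell :: "int \<Rightarrow> int \<Rightarrow> int" where
  "other_cell i \<kappa> = (if \<kappa> = i then i + 1 else i - 1)"

text \<open>On each half cell the pressure derivative is integrated exactly. Hence in the terms with the averaged
  ratio \<open>R\<close> the values of the pressure at the ends of the cell cancel, and what remains is the
  jump of the pressure at the centre, times \<open>R\<close>. Expanding \<open>R\<close> by the same nodes collects everything
  into \<open>phi_hat_x\<close>.\<close>

lemma source_pairing_quadrature:
  assumes grid: "uniform_grid x dx" and N: "N \<ge> k + 1"
    and P: "\<And>\<kappa>. \<kappa> \<in> {i - 1, i} \<Longrightarrow> polynomial3 k (P \<kappa>)"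
    and UB: "\<And>\<kappa> y. \<kappa> \<in> {i - 1, i} \<Longrightarrow> y \<in> {x \<kappa><..<x (\<kappa> + 1)} \<Longrightarrow> UB y = P \<kappa> y"
    and q: "\<And>\<kappa>. \<kappa> \<in> {i - 1, i} \<Longrightarrow> degree (q \<kappa>) \<le> k"
    and ps: "\<And>\<kappa> y. \<kappa> \<in> {i - 1, i} \<Longrightarrow> y \<in> cell x (other_cell i \<kappa>) \<Longrightarrow> psB y = poly (q \<kappa>) y"
  shows "source_pairing x dx N i UB \<rho>sB psB =
    - dx *\<^sub>R (\<Sum>(\<kappa>, \<xi>)\<in>{i - 1, i} \<times> gauss_nodes N.
        (gauss_weight N \<xi> / 2 * phi_hat_x x dx i \<rho>sB psB (half_node x \<kappa> \<xi>))
          *\<^sub>R source_vec (P \<kappa> (half_node x \<kappa> \<xi>)))"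
proof -
  have dx: "dx > 0" using grid by (simp add: uniform_grid_def)
  let ?G = "gauss_nodes N" and ?w = "gauss_weight N"
  define Z where "Z = {i - 1, i} \<times> ?G"
  define y where "y z = half_node x (fst z) (snd z)" for z
  define W where "W z = ?w (snd z) / 2" for z :: "int \<times> real"
  define Q where "Q z = source_vec (P (fst z) (y z))" for z
  define c where "c = cell_avg x dx i \<rho>sB"
  define d where "d z = deriv psB (y z)" for z
  define R where "R = (1 / c) *\<^sub>R (\<Sum>z\<in>Z. W z *\<^sub>R Q z)"
  have y_in: "y z \<in> {x (fst z)<..<x (fst z + 1)}" if "z \<in> Z" for z
    unfolding y_def
    by (rule half_node_inside[OF grid]) (use that gauss_nodes_interior[of N] in \<open>auto simp: Z_def\<close>)
  have cell_half: "{x \<kappa><..<x (\<kappa> + 1)} \<subseteq> cell x (other_cell i \<kappa>)" if "\<kappa> \<in> {i - 1, i}" for \<kappa>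
    by (rule half_subset_cell[OF grid]) (use that in \<open>auto simp: other_cell_def\<close>)
  have R: "(1 / c) *\<^sub>R cell_avg x dx i (\<lambda>y. source_vec (UB y)) = R"
    using cell_avg_quadrature[OF grid quadrature_exact_gauss[OF N],
        of i "\<lambda>\<kappa> y. source_vec (P \<kappa> y)" "\<lambda>y. source_vec (UB y)"] P UB
    by (simp add: polynomial3_source_vec R_def Z_def W_def Q_def y_def case_prod_unfold)
  have d_eq: "d z = poly (pderiv (q (fst z))) (y z)" if "z \<in> Z" for z
  proof -
    have z: "fst z \<in> {i - 1, i}" using that by (auto simp: Z_def)
    moreover have "y z \<in> cell x (other_cell i (fst z))"
      using y_in[OF that] cell_half[OF z] by blast
    ultimately have "eventually (\<lambda>u. psB u = poly (q (fst z)) u) (nhds (y z))"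
      using ps eventually_nhds_in_open[of "cell x (other_cell i (fst z))" "y z"]
      by (auto simp: cell_def elim!: eventually_mono)
    then have "d z = deriv (poly (q (fst z))) (y z)"
      unfolding d_def by (intro deriv_cong_ev) auto
    then show ?thesis using DERIV_imp_deriv[OF poly_DERIV] by metis
  qed
  have lims: "Lim (at_left (x i)) psB = poly (q (i - 1)) (x i)"
    "Lim (at_right (x i)) psB = poly (q i) (x i)"
  proof -
    have lt: "x \<kappa> < x (\<kappa> + 1)" for \<kappa> using dx by (simp add: grid_step[OF grid])
    have ps_half: "psB u = poly (q \<kappa>) u" if "\<kappa> \<in> {i - 1, i}" "u \<in> {x \<kappa><..<x (\<kappa> + 1)}" for \<kappa> u
      using ps cell_half that by blast
    show "Lim (at_left (x i)) psB = poly (q (i - 1)) (x i)"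
      using pw_poly_Lim(2)[OF lt[of "i - 1"] ps_half] by simp
    show "Lim (at_right (x i)) psB = poly (q i) (x i)"
      using pw_poly_Lim(1)[OF lt[of i] ps_half] by simp
  qed
  have ends: "psB (x (i + 1)) = poly (q i) (x (i + 1))" "psB (x (i - 1)) = poly (q (i - 1)) (x (i - 1))"
    using ps[of i] ps[of "i - 1"] center_in_cell[OF grid] by (auto simp: other_cell_def)
  have deriv_sum: "dx * (\<Sum>z\<in>Z. W z * d z)
      = (poly (q (i - 1)) (x i) - poly (q (i - 1)) (x (i - 1))) + (poly (q i) (x (i + 1)) - poly (q i) (x i))"
  proof -
    have half: "dx / 2 * (\<Sum>\<xi>\<in>?G. ?w \<xi> * poly (pderiv (q \<kappa>)) (half_node x \<kappa> \<xi>))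
        = poly (q \<kappa>) (x (\<kappa> + 1)) - poly (q \<kappa>) (x \<kappa>)" if "\<kappa> \<in> {i - 1, i}" for \<kappa>
    proof -
      have "degree (pderiv (q \<kappa>)) \<le> k" using q[OF that] by (simp add: degree_pderiv)
      then have "integral {x \<kappa>..x (\<kappa> + 1)} (poly (pderiv (q \<kappa>)))
          = dx / 2 * (\<Sum>\<xi>\<in>?G. ?w \<xi> * poly (pderiv (q \<kappa>)) (half_node x \<kappa> \<xi>))"
        by (intro integral_unique half_interval_quadrature[OF grid quadrature_exact_gauss[OF N]])
      moreover have "x \<kappa> \<le> x (\<kappa> + 1)" using dx by (simp add: grid_step[OF grid])
      ultimately show ?thesis by (simp only: integral_poly_pderiv)
    qed
    have "(\<Sum>z\<in>Z. W z * d z) = (\<Sum>z\<in>Z. W z * poly (pderiv (q (fst z))) (y z))"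
      by (intro sum.cong) (auto simp: d_eq)
    also have "\<dots> = (\<Sum>\<kappa>\<in>{i - 1, i}. \<Sum>\<xi>\<in>?G. ?w \<xi> / 2 * poly (pderiv (q \<kappa>)) (half_node x \<kappa> \<xi>))"
      by (simp add: Z_def sum.cartesian_product W_def y_def case_prod_unfold)
    finally have "dx * (\<Sum>z\<in>Z. W z * d z)
        = (\<Sum>\<kappa>\<in>{i - 1, i}. dx / 2 * (\<Sum>\<xi>\<in>?G. ?w \<xi> * poly (pderiv (q \<kappa>)) (half_node x \<kappa> \<xi>)))"
      by (simp add: sum_distrib_left mult_ac del: sum.insert)
    also have "\<dots> = (\<Sum>\<kappa>\<in>{i - 1, i}. poly (q \<kappa>) (x (\<kappa> + 1)) - poly (q \<kappa>) (x \<kappa>))"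
      by (intro sum.cong refl half)
    finally show ?thesis by simp
  qed
  have "source_pairing x dx N i UB \<rho>sB psB
      = (psB (x (i + 1)) - psB (x (i - 1))) *\<^sub>R R
        + dx *\<^sub>R (\<Sum>z\<in>Z. (W z * d z) *\<^sub>R ((1 / \<rho>sB (y z)) *\<^sub>R Q z - R))"
  proof -
    have "(\<Sum>\<kappa>\<in>{i - 1, i}. \<Sum>\<xi>\<in>?G. let y = half_node x \<kappa> \<xi>
              in (?w \<xi> * deriv psB y) *\<^sub>R ((1 / \<rho>sB y) *\<^sub>R source_vec (UB y) - R))
        = (\<Sum>z\<in>Z. 2 *\<^sub>R ((W z * d z) *\<^sub>R ((1 / \<rho>sB (y z)) *\<^sub>R Q z - R)))"
      unfolding sum.cartesian_product Z_def[symmetric]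
    proof (intro sum.cong refl)
      fix z assume z: "z \<in> Z"
      have "UB (y z) = P (fst z) (y z)"
        using UB[OF _ y_in[OF z]] z by (auto simp: Z_def)
      then show "(case z of (\<kappa>, \<xi>) \<Rightarrow> let y = half_node x \<kappa> \<xi>
              in (?w \<xi> * deriv psB y) *\<^sub>R ((1 / \<rho>sB y) *\<^sub>R source_vec (UB y) - R))
          = 2 *\<^sub>R ((W z * d z) *\<^sub>R ((1 / \<rho>sB (y z)) *\<^sub>R Q z - R))"
        by (simp add: case_prod_unfold Let_def W_def d_def Q_def y_def)
    qed
    also have "\<dots> = 2 *\<^sub>R (\<Sum>z\<in>Z. (W z * d z) *\<^sub>R ((1 / \<rho>sB (y z)) *\<^sub>R Q z - R))"
      by (simp only: scaleR_sum_right)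
    finally show ?thesis
      unfolding source_pairing_def R[unfolded c_def] Let_def by (simp only: scaleR_scaleR) simp
  qed
  also have "\<dots> = (psB (x (i + 1)) - psB (x (i - 1)) - dx * (\<Sum>z\<in>Z. W z * d z)) *\<^sub>R R
        + dx *\<^sub>R (\<Sum>z\<in>Z. (W z * d z / \<rho>sB (y z)) *\<^sub>R Q z)"
    by (simp add: scaleR_diff_right sum_subtractf scaleR_left.sum[symmetric] algebra_simps)
  also have "psB (x (i + 1)) - psB (x (i - 1)) - dx * (\<Sum>z\<in>Z. W z * d z)
      = - (Lim (at_left (x i)) psB - Lim (at_right (x i)) psB)"
    by (simp add: deriv_sum ends lims)
  also have "\<dots> *\<^sub>R R + dx *\<^sub>R (\<Sum>z\<in>Z. (W z * d z / \<rho>sB (y z)) *\<^sub>R Q z)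
      = - dx *\<^sub>R (\<Sum>z\<in>Z. (W z * phi_hat_x x dx i \<rho>sB psB (y z)) *\<^sub>R Q z)"
  proof -
    define J where "J = Lim (at_left (x i)) psB - Lim (at_right (x i)) psB"
    have "- dx *\<^sub>R (\<Sum>z\<in>Z. (W z * phi_hat_x x dx i \<rho>sB psB (y z)) *\<^sub>R Q z)
        = (\<Sum>z\<in>Z. (- J) *\<^sub>R ((1 / c) *\<^sub>R (W z *\<^sub>R Q z)) + dx *\<^sub>R ((W z * d z / \<rho>sB (y z)) *\<^sub>R Q z))"
      unfolding scaleR_sum_right
    proof (intro sum.cong refl)
      fix z
      have "- dx * (W z * phi_hat_x x dx i \<rho>sB psB (y z)) = - J * (1 / c * W z) + dx * (W z * d z / \<rho>sB (y z))"
      proof -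
        have "dx * phi_hat_x x dx i \<rho>sB psB (y z) = J / c - dx * (d z / \<rho>sB (y z))"
        proof -
          have "phi_hat_x x dx i \<rho>sB psB (y z) = J / (c * dx) - d z / \<rho>sB (y z)"
            by (simp add: phi_hat_x_def J_def c_def d_def)
          then show ?thesis using dx by (simp add: right_diff_distrib)
        qed
        from arg_cong[OF this, of "\<lambda>u. - W z * u"] show ?thesis by (simp add: algebra_simps)
      qed
      then show "- dx *\<^sub>R ((W z * phi_hat_x x dx i \<rho>sB psB (y z)) *\<^sub>R Q z)
          = (- J) *\<^sub>R ((1 / c) *\<^sub>R (W z *\<^sub>R Q z)) + dx *\<^sub>R ((W z * d z / \<rho>sB (y z)) *\<^sub>R Q z)"
        by (simp only: scaleR_scaleR scaleR_left_distrib[symmetric] mult.assoc)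
    qed
    then show ?thesis
      unfolding R_def J_def[symmetric] by (simp only: sum.distrib scaleR_sum_right)
  qed
  finally show ?thesis
    by (simp add: Z_def W_def Q_def y_def case_prod_unfold)
qed


lemma all_points_node:
  assumes "j = \<kappa> \<or> j = \<kappa> + 1" and "\<xi> \<in> gauss_nodes N \<union> lobatto_nodes (lobatto_size k)"
  shows "half_node x \<kappa> \<xi> \<in> all_points x k N j"
  using assms by (auto simp: all_points_def gauss_points_def)

lemma half_node_closed:
  assumes "uniform_grid x dx" and "j = \<kappa> \<or> j = \<kappa> + 1" and "\<xi> \<in> {-1..1}"
  shows "half_node x \<kappa> \<xi> \<in> {x (j - 1)..x (j + 1)}"
proof -
  have dx: "dx > 0" using assms(1) by (simp add: uniform_grid_def)
  have "dx / 4 * (1 + \<xi>) \<ge> 0" using dx assms(3) by simp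
  moreover have "dx / 4 * (1 + \<xi>) \<le> dx / 4 * 2"
    using dx assms(3) by (intro mult_left_mono) auto
  ultimately have "half_node x \<kappa> \<xi> \<in> {x \<kappa>..x \<kappa> + dx / 2}"
    using assms(1) by (simp add: half_node_grid)
  then show ?thesis
    using assms(2) dx grid_step[OF assms(1)] grid_step'[OF assms(1)] by auto
qed

text \<open>On a single cell the time step restriction is exactly the room needed to split \<open>\<theta>\<close> between the
  source and the flux.\<close>

lemma cell_update_admissible:
  fixes \<gamma> dx dt \<tau>max \<theta> :: real and J :: "int set"
  assumes \<gamma>: "\<gamma> > 1" and N: "N \<ge> k + 1" and grid: "uniform_grid x dx" and dt: "dt > 0"
    and theta: "\<theta> = dt / \<tau>max" "\<theta> \<in> {0<..1}"
    and UB: "UB \<in> pw_poly3 x J k" and ps: "psB \<in> pw_poly x J k"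
    and J: "i - 1 \<in> J" "i + 1 \<in> J"
    and adm: "\<And>j y. j \<in> J \<Longrightarrow> y \<in> all_points x k N j \<Longrightarrow> cell_value x j UB y \<in> admissible \<gamma>"
    and avg: "cell_avg x dx i UA \<in> admissible \<gamma>"
    and CFL: "dt / dx * alpha_cell \<gamma> x dx k N i UB \<rho>sB psB < \<theta> * lobatto_end_weight k / 2"
  shows "cell_avg x dx i UA + dt *\<^sub>R cell_operator \<gamma> x dx \<tau>max N i UA UB \<rho>sB psB \<in> admissible \<gamma>"
proof -
  have dx: "dx > 0" using grid by (simp add: uniform_grid_def)
  define L where "L = lobatto_size k"
  define \<omega> where "\<omega> = lobatto_end_weight k"
  have L2: "L \<ge> 2" using lobatto_size_props by (simp add: L_def)
  have \<omega>: "\<omega> > 0" "lobatto_weight L (-1) = \<omega>" "lobatto_weight L 1 = \<omega>"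
    using lobatto_weight_pos[OF L2, of "-1"] lobatto_end_weights_equal[OF L2]
    by (auto simp: \<omega>_def lobatto_end_weight_def L_def lobatto_nodes_def)
  have J': "other_cell i \<kappa> \<in> J" for \<kappa>
    using J by (auto simp: other_cell_def)
  have "\<forall>\<kappa>. \<exists>P. polynomial3 k P \<and> (\<forall>y\<in>cell x (other_cell i \<kappa>). UB y = P y)"
    using pw_poly3_trace[OF UB J'] by blast
  from choice[OF this] obtain P where P: "\<And>\<kappa>. polynomial3 k (P \<kappa>)"
    "\<And>\<kappa> y. y \<in> cell x (other_cell i \<kappa>) \<Longrightarrow> UB y = P \<kappa> y" by blast
  have "\<forall>\<kappa>. \<exists>q. degree q \<le> k \<and> (\<forall>y\<in>cell x (other_cell i \<kappa>). psB y = poly q y)"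
    using ps J' by (simp add: pw_poly_def)
  from choice[OF this] obtain q where q: "\<And>\<kappa>. degree (q \<kappa>) \<le> k"
    "\<And>\<kappa> y. y \<in> cell x (other_cell i \<kappa>) \<Longrightarrow> psB y = poly (q \<kappa>) y" by blast
  have adj: "other_cell i \<kappa> = \<kappa> \<or> other_cell i \<kappa> = \<kappa> + 1" if "\<kappa> \<in> {i - 1, i}" for \<kappa>
    using that by (auto simp: other_cell_def)
  have UB_half: "UB y = P \<kappa> y" if "\<kappa> \<in> {i - 1, i}" "y \<in> {x \<kappa><..<x (\<kappa> + 1)}" for \<kappa> y
    using P(2) half_subset_cell[OF grid adj[OF that(1)]] that(2) by blast
  have G: "P \<kappa> (half_node x \<kappa> \<xi>) \<in> admissible \<gamma>"
    if "\<kappa> \<in> {i - 1, i}" "\<xi> \<in> gauss_nodes N \<union> lobatto_nodes L" for \<kappa> \<xi>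
  proof -
    have "\<xi> \<in> {-1..1}"
      using that(2) gauss_nodes_interior[of N] lobatto_nodes_bounds[OF L2]
      by (auto simp: subset_iff less_imp_le)
    from half_node_closed[OF grid adj[OF that(1)] this]
    have "cell_value x (other_cell i \<kappa>) UB (half_node x \<kappa> \<xi>) = P \<kappa> (half_node x \<kappa> \<xi>)"
      using P by (intro cell_value_closure[OF grid]) (auto intro: polynomial3_continuous)
    with adm[OF J' all_points_node[OF adj[OF that(1)] that(2)[unfolded L_def]]] show ?thesis by simp
  qed
  define V where "V z = P (fst z) (half_node x (fst z) (snd z))" for z
  define Zg where "Zg = {i - 1, i} \<times> gauss_nodes N"
  define Zl where "Zl = {i - 1, i} \<times> lobatto_nodes L"
  define Wg where "Wg z = gauss_weight N (snd z) / 2" for z :: "int \<times> real"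
  define Wl where "Wl z = lobatto_weight L (snd z) / 2" for z :: "int \<times> real"
  have Zg: "finite Zg" "Zg \<noteq> {}"
    using card_gauss_nodes[of N] finite_gauss_nodes[of N] N by (auto simp: Zg_def)
  have Zl: "finite Zl" using finite_lobatto_nodes[OF L2] by (simp add: Zl_def)
  have Wg: "Wg z > 0" if "z \<in> Zg" for z
    using that gauss_weight_pos by (auto simp: Zg_def Wg_def)
  have Wl: "Wl z > 0" if "z \<in> Zl" for z
    using that lobatto_weight_pos[OF L2] by (auto simp: Zl_def Wl_def)
  have V: "V z \<in> admissible \<gamma>" if "z \<in> Zg \<union> Zl" for z
    using that G by (auto simp: V_def Zg_def Zl_def)
  have avg_g: "cell_avg x dx i UB = (\<Sum>z\<in>Zg. Wg z *\<^sub>R V z)"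
    using cell_avg_quadrature[OF grid quadrature_exact_gauss[OF N] P(1) UB_half]
    by (simp add: Zg_def Wg_def V_def case_prod_unfold)
  have avg_l: "cell_avg x dx i UB = (\<Sum>z\<in>Zl. Wl z *\<^sub>R V z)"
    using cell_avg_quadrature[OF grid quadrature_exact_lobatto P(1) UB_half]
    by (simp add: Zl_def Wl_def V_def L_def case_prod_unfold)
  define \<psi> where "\<psi> z = phi_hat_x x dx i \<rho>sB psB (half_node x (fst z) (snd z))" for z
  have source: "source_pairing x dx N i UB \<rho>sB psB
      = - dx *\<^sub>R (\<Sum>z\<in>Zg. (Wg z * \<psi> z) *\<^sub>R source_vec (V z))"
    using source_pairing_quadrature[OF grid N P(1) UB_half q(1) q(2), where \<rho>sB = \<rho>sB]
    by (simp add: Zg_def Wg_def V_def \<psi>_def case_prod_unfold)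
  \<comment> \<open>The Lobatto nodes at the left and right end of the cell.\<close>
  define z0 z1 where z01: "z0 = (i - 1, -1 :: real)" "z1 = (i, 1 :: real)"
  have z01_in: "z0 \<in> Zl" "z1 \<in> Zl" "z0 \<noteq> z1" and W01: "Wl z0 = \<omega> / 2" "Wl z1 = \<omega> / 2"
    using \<omega> by (auto simp: z01 Zl_def Wl_def lobatto_nodes_def)
  have V01: "UB (x (i - 1)) = V z0" "UB (x (i + 1)) = V z1"
  proof -
    have "half_node x (i - 1) (-1) = x (i - 1)" "half_node x i 1 = x (i + 1)"
      by (simp_all add: half_node_grid[OF grid] grid_step[OF grid])
    moreover have "UB (x (i - 1)) = P (i - 1) (x (i - 1))" "UB (x (i + 1)) = P i (x (i + 1))"
      using center_in_cell[OF grid] by (auto intro!: P(2) simp: other_cell_def)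
    ultimately show "UB (x (i - 1)) = V z0" "UB (x (i + 1)) = V z1"
      by (simp_all add: V_def z01)
  qed

  define \<nu> where "\<nu> = dt / dx"
  have \<nu>: "\<nu> > 0" using dt dx by (simp add: \<nu>_def)
  define g where "g y = \<bar>phi_hat_x x dx i \<rho>sB psB y\<bar> * sqrt ((\<gamma> - 1) * UB y $ 1 / (2 * pressure \<gamma> (UB y)))" for y
  define M where "M = Max (g ` gauss_points x N i)"
  have points: "gauss_points x N i = (\<lambda>z. half_node x (fst z) (snd z)) ` Zg"
    by (auto simp: gauss_points_def Zg_def image_iff)
  have gV: "g (half_node x (fst z) (snd z)) = \<bar>\<psi> z\<bar> * sqrt ((\<gamma> - 1) * V z $ 1 / (2 * pressure \<gamma> (V z)))"
    if "z \<in> Zg" for z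
  proof -
    have "UB (half_node x (fst z) (snd z)) = V z"
      unfolding V_def using that gauss_nodes_interior[of N]
      by (intro UB_half half_node_inside[OF grid]) (auto simp: Zg_def)
    then show ?thesis by (simp add: g_def \<psi>_def)
  qed
  have g_le: "\<bar>\<psi> z\<bar> * sqrt ((\<gamma> - 1) * V z $ 1 / (2 * pressure \<gamma> (V z))) \<le> M" if "z \<in> Zg" for z
    unfolding gV[OF that, symmetric] M_def points using Zg(1) that by (intro Max_ge) auto
  have M0: "M \<ge> 0"
  proof -
    obtain z where z: "z \<in> Zg" using Zg(2) by blast
    have "0 \<le> \<bar>\<psi> z\<bar> * sqrt ((\<gamma> - 1) * V z $ 1 / (2 * pressure \<gamma> (V z)))"
      using V[of z] z \<gamma> by (simp add: admissible_def)
    also note g_le[OF z]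
    finally show ?thesis .
  qed
  define a1 where "a1 = alpha1 \<gamma> x i UB"
  have a1: "wave_speed \<gamma> (V z0) \<le> a1" "wave_speed \<gamma> (V z1) \<le> a1"
    by (simp_all add: a1_def alpha1_def V01)
  have "a1 \<ge> 0" using a1(1) wave_speed_nonneg[OF \<gamma> V[of z0]] z01_in by simp
  \<comment> \<open>The flux needs a share above \<open>s\<close>, the source a share above \<open>dt * M\<close>.\<close>
  define s where "s = 2 * \<nu> * a1 / \<omega>"
  have "s \<ge> 0" using \<nu> \<open>a1 \<ge> 0\<close> \<omega> by (simp add: s_def)
  have "\<omega> / 2 * (s + dt * M) = \<nu> * (a1 + \<omega> * dx / 2 * M)"
    using dx \<omega> by (simp add: \<nu>_def s_def field_simps)
  also have "\<dots> < \<theta> * \<omega> / 2"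
    using CFL by (simp add: alpha_cell_def alpha2_def a1_def \<nu>_def \<omega>_def M_def g_def)
  also have "\<dots> = \<omega> / 2 * \<theta>" by simp
  finally have "\<omega> / 2 * (s + dt * M) < \<omega> / 2 * \<theta>" .
  then have budget: "s + dt * M < \<theta>" using \<omega> by simp
  \<comment> \<open>The midpoint of the interval of possible shares for the source.\<close>
  define \<eta> where "\<eta> = (dt * M + (\<theta> - s)) / 2"
  have \<eta>: "dt * M < \<eta>" "s < \<theta> - \<eta>" using budget by (auto simp: \<eta>_def field_simps)
  have "dt * M \<ge> 0" using dt M0 by simp
  with \<eta> \<open>s \<ge> 0\<close> have pos: "\<eta> > 0" "\<theta> - \<eta> > 0" by linarith+
  have part_source: "\<eta> *\<^sub>R (\<Sum>z\<in>Zg. Wg z *\<^sub>R V z) + (\<Sum>z\<in>Zg. (Wg z * (- dt * \<psi> z)) *\<^sub>R source_vec (V z)) \<in> admissible \<gamma>"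
  proof (intro admissible_average_with_source \<gamma> Zg Wg pos(1))
    fix z assume z: "z \<in> Zg"
    have "\<bar>- dt * \<psi> z\<bar> * sqrt ((\<gamma> - 1) * V z $ 1 / (2 * pressure \<gamma> (V z))) \<le> dt * M"
      using mult_left_mono[OF g_le[OF z], of dt] dt by (simp add: abs_mult mult_ac)
    with \<eta> show "\<bar>- dt * \<psi> z\<bar> * sqrt ((\<gamma> - 1) * V z $ 1 / (2 * pressure \<gamma> (V z))) < \<eta>" by linarith
  qed (use V in auto)
  have flux_bound: "\<nu> * v < (\<theta> - \<eta>) * (\<omega> / 2)" if "v \<le> a1" for v
  proof -
    have "\<nu> * v \<le> \<nu> * a1" using that \<nu> by simp
    also have "\<dots> = s * (\<omega> / 2)" using \<omega> by (simp add: s_def)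
    also have "\<dots> < (\<theta> - \<eta>) * (\<omega> / 2)" using \<eta> \<omega> by (intro mult_strict_right_mono) auto
    finally show ?thesis .
  qed
  have part_flux: "(\<theta> - \<eta>) *\<^sub>R (\<Sum>z\<in>Zl. Wl z *\<^sub>R V z) - \<nu> *\<^sub>R (flux \<gamma> (V z1) - flux \<gamma> (V z0)) \<in> admissible \<gamma>"
  proof (rule admissible_average_with_flux[where V = V and W = Wl and ?z0.0 = z0 and ?z1.0 = z1,
        OF \<gamma> Zl Wl _ pos(2) _ z01_in])
    show "\<nu> * wave_speed \<gamma> (V z0) < (\<theta> - \<eta>) * Wl z0"
      "\<nu> * wave_speed \<gamma> (V z1) < (\<theta> - \<eta>) * Wl z1"
      unfolding W01 by (rule flux_bound[OF a1(1)], rule flux_bound[OF a1(2)])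
  qed (use V \<nu> in auto)
  define A where "A = cell_avg x dx i UA"
  define B where "B = cell_avg x dx i UB"
  have split: "A + dt *\<^sub>R cell_operator \<gamma> x dx \<tau>max N i UA UB \<rho>sB psB
      = (1 - \<theta>) *\<^sub>R A
        + ((\<eta> *\<^sub>R B + (\<Sum>z\<in>Zg. (Wg z * (- dt * \<psi> z)) *\<^sub>R source_vec (V z)))
           + ((\<theta> - \<eta>) *\<^sub>R B - \<nu> *\<^sub>R (flux \<gamma> (V z1) - flux \<gamma> (V z0))))"
  proof -
    define S where "S = (\<Sum>z\<in>Zg. (Wg z * \<psi> z) *\<^sub>R source_vec (V z))"
    have "(\<Sum>z\<in>Zg. (Wg z * (- dt * \<psi> z)) *\<^sub>R source_vec (V z)) = (- dt) *\<^sub>R S"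
      by (simp add: S_def scaleR_sum_right mult_ac sum_negf)
    moreover have "dt *\<^sub>R cell_operator \<gamma> x dx \<tau>max N i UA UB \<rho>sB psB
        = \<theta> *\<^sub>R (B - A) - \<nu> *\<^sub>R (flux \<gamma> (V z1) - flux \<gamma> (V z0)) + (- dt) *\<^sub>R S"
      using dx by (simp add: cell_operator_def source V01 theta(1) \<nu>_def A_def B_def S_def
          scaleR_add_right scaleR_diff_right)
    ultimately show ?thesis by (simp add: algebra_simps)
  qed
  have rest: "(\<eta> *\<^sub>R B + (\<Sum>z\<in>Zg. (Wg z * (- dt * \<psi> z)) *\<^sub>R source_vec (V z)))
           + ((\<theta> - \<eta>) *\<^sub>R B - \<nu> *\<^sub>R (flux \<gamma> (V z1) - flux \<gamma> (V z0))) \<in> admissible \<gamma>"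
    using part_source part_flux unfolding avg_g[symmetric] avg_l[symmetric] B_def[symmetric]
    by (rule admissible_add[OF \<gamma>])
  \<comment> \<open>The zero vector is not admissible, so the first summand has to be dropped if \<open>\<theta> = 1\<close>.\<close>
  have "A + dt *\<^sub>R cell_operator \<gamma> x dx \<tau>max N i UA UB \<rho>sB psB \<in> admissible \<gamma>"
  proof (cases "\<theta> = 1")
    case True
    then show ?thesis unfolding split using rest by simp
  next
    case False
    then have "(1 - \<theta>) *\<^sub>R A \<in> admissible \<gamma>"
      using theta(2) avg by (intro admissible_scaleR) (auto simp: A_def)
    then show ?thesis unfolding split using rest by (rule admissible_add[OF \<gamma>])
  qed
  then show ?thesis by (simp add: A_def)
qed

theorem theorem3p2:
  fixes \<gamma> dx dt \<tau>max \<theta> :: real and k N :: nat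
    and x :: "int \<Rightarrow> real" and K :: "int set"
    and \<phi> \<phi>x \<rho>s ps :: "real \<Rightarrow> real"
    and UC UD UsC UsD :: "real \<Rightarrow> real^3"
    and \<rho>sC \<rho>sD psC psD :: "real \<Rightarrow> real"
  assumes "\<gamma> > 1" and "k \<ge> 1" and "N \<ge> k + 1"
    and "uniform_grid x dx" and "finite K"
    and "dt > 0" and "\<tau>max > 0"
    and potential: "\<And>y. y \<in> mesh_domain x K \<Longrightarrow>
          (\<phi> has_real_derivative \<phi>x y) (at y within mesh_domain x K)"
    and hydrostatic: "\<And>y. y \<in> mesh_domain x K \<Longrightarrow>
          (ps has_real_derivative - \<rho>s y * \<phi>x y) (at y within mesh_domain x K)"
    and integrable: "\<rho>s absolutely_integrable_on mesh_domain x K"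
    and spaces: "UC \<in> pw_poly3 x (primal_cells K) k" "UD \<in> pw_poly3 x (dual_cells K) k"
    and proj_C: "is_projection3 x dx (primal_cells K) k (hydrostatic_state \<gamma> \<rho>s ps) UsC"
          "\<rho>sC = (\<lambda>y. UsC y $ 1)" "is_projection x dx (primal_cells K) k ps psC"
    and proj_D: "is_projection3 x dx (dual_cells K) k (hydrostatic_state \<gamma> \<rho>s ps) UsD"
          "\<rho>sD = (\<lambda>y. UsD y $ 1)" "is_projection x dx (dual_cells K) k ps psD"
    and adm_C: "\<And>i y. i \<in> primal_cells K \<Longrightarrow> y \<in> all_points x k N i \<Longrightarrow>
          cell_value x i UC y \<in> admissible \<gamma> \<and> cell_value x i UsC y \<in> admissible \<gamma>"
    and adm_D: "\<And>i y. i \<in> dual_cells K \<Longrightarrow> y \<in> all_points x k N i \<Longrightarrow>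
          cell_value x i UD y \<in> admissible \<gamma> \<and> cell_value x i UsD y \<in> admissible \<gamma>"
    and avg_C: "\<And>i. i \<in> primal_cells K \<Longrightarrow> cell_avg x dx i UC \<in> admissible \<gamma>"
    and avg_D: "\<And>i. i \<in> dual_cells K \<Longrightarrow> cell_avg x dx i UD \<in> admissible \<gamma>"
    and theta: "\<theta> = dt / \<tau>max" "\<theta> \<in> {0<..1}"
    and CFL: "dt / dx * alpha_max \<gamma> x dx k N K UC \<rho>sC psC UD \<rho>sD psD
                < \<theta> * lobatto_end_weight k / 2"
  shows "(\<forall>i\<in>primal_cells (both_overlaps K).
            cell_avg x dx i UC + dt *\<^sub>R cell_operator \<gamma> x dx \<tau>max N i UC UD \<rho>sD psD
              \<in> admissible \<gamma>) \<and>
         (\<forall>i\<in>dual_cells (both_overlaps K).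
            cell_avg x dx i UD + dt *\<^sub>R cell_operator \<gamma> x dx \<tau>max N i UD UC \<rho>sC psC
              \<in> admissible \<gamma>)"
proof -
  have fin: "finite (primal_cells (both_overlaps K))" "finite (dual_cells (both_overlaps K))"
    by (rule finite_subset[OF _ \<open>finite K\<close>],
        force simp: primal_cells_def dual_cells_def both_overlaps_def)+
  have ratio: "dt / dx > 0"
    using \<open>dt > 0\<close> \<open>uniform_grid x dx\<close> by (simp add: uniform_grid_def)
  have CFL': "dt / dx * a < \<theta> * lobatto_end_weight k / 2"
    if "a \<le> alpha_max \<gamma> x dx k N K UC \<rho>sC psC UD \<rho>sD psD" for a
    using mult_left_mono[OF that, of "dt / dx"] ratio CFL by linarith
  have "cell_avg x dx i UC + dt *\<^sub>R cell_operator \<gamma> x dx \<tau>max N i UC UD \<rho>sD psD \<in> admissible \<gamma>"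
    if i: "i \<in> primal_cells (both_overlaps K)" for i
  proof (rule cell_update_admissible[where J = "dual_cells K"])
    show "psD \<in> pw_poly x (dual_cells K) k" using proj_D(3) by (simp add: is_projection_def)
    show "i - 1 \<in> dual_cells K" "i + 1 \<in> dual_cells K"
      using i by (auto simp: primal_cells_def dual_cells_def both_overlaps_def)
    show "cell_avg x dx i UC \<in> admissible \<gamma>"
      using i by (intro avg_C) (auto simp: primal_cells_def both_overlaps_def)
    show "dt / dx * alpha_cell \<gamma> x dx k N i UD \<rho>sD psD < \<theta> * lobatto_end_weight k / 2"
      using fin i unfolding alpha_max_def by (intro CFL'[unfolded alpha_max_def] Max_ge) auto
    show "cell_value x j UD y \<in> admissible \<gamma>"
      if "j \<in> dual_cells K" "y \<in> all_points x k N j" for j y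
      using adm_D[OF that] by (rule conjunct1)
  qed (rule assms(1) assms(3) assms(4) assms(6) theta spaces)+
  moreover have "cell_avg x dx i UD + dt *\<^sub>R cell_operator \<gamma> x dx \<tau>max N i UD UC \<rho>sC psC \<in> admissible \<gamma>"
    if i: "i \<in> dual_cells (both_overlaps K)" for i
  proof (rule cell_update_admissible[where J = "primal_cells K"])
    show "psC \<in> pw_poly x (primal_cells K) k" using proj_C(3) by (simp add: is_projection_def)
    show "i - 1 \<in> primal_cells K" "i + 1 \<in> primal_cells K"
      using i by (auto simp: primal_cells_def dual_cells_def both_overlaps_def)
    show "cell_avg x dx i UD \<in> admissible \<gamma>"
      using i by (intro avg_D) (auto simp: dual_cells_def both_overlaps_def)
    show "dt / dx * alpha_cell \<gamma> x dx k N i UC \<rho>sC psC < \<theta> * lobatto_end_weight k / 2"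
      using fin i unfolding alpha_max_def by (intro CFL'[unfolded alpha_max_def] Max_ge) auto
    show "cell_value x j UC y \<in> admissible \<gamma>"
      if "j \<in> primal_cells K" "y \<in> all_points x k N j" for j y
      using adm_C[OF that] by (rule conjunct1)
  qed (rule assms(1) assms(3) assms(4) assms(6) theta spaces)+
  ultimately show ?thesis by blast
qed

end
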